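(* Let $d$ be a positive integer and let $G$ be a $d$-stress-independent graph. Then: (a) $G$ is $\mathcal{R}_{d+1}$-independent; (b) for every subgraph $G'=(V',E')$ of $G$ with $|V'|\ge d+2$ we have \[|E'|\le r_d(G')+|V'|-d-1\le (d+1)|V'|-\binom{d+2}{2},\] and the first inequality holds with equality if and only if $G'$ is a complete graph $K_{d+2}$.
   Context: All graphs are finite and simple. For a positive integer $k$, $\mathcal{R}_k(G)$ is the row matroid of the rigidity matrix $R(G,p)$ of a generic framework $p:V\to\mathbb{R}^k$ (coordinates algebraically independent over $\mathbb{Q}$; row of edge $xy$ has $p(x)-p(y)$ in the columns of $x$, $p(y)-p(x)$ in those of $y$, zeros elsewhere); $r_k(G)$ is its rank. $G$ is $\mathcal{R}_k$-independent if $E(G)$ is independent in $\mathcal{R}_k(G)$. $\{u,v\}$ is $d$-linked in $G$ if $r_d(G+uv)=r_d(G)$. A stress of $(G,p)$ is $\omega\in\mathbb{R}^E$ with $\sum_{x:xy\in E}\omega(xy)(p(x)-p(y))=0$ for all $y$; $S(G,p)$ is the stress space. $\{u,v\}$ is $d$-stress-linked in $G$ if it is $d$-linked and for every generic $(G,p)$ in $\mathbb{R}^d$ and every $(G,q)$ in $\mathbb{R}^d$ with $S(G,p)\subseteq S(G,q)$ we have $S(G+uv,p)\subseteq S(G+uv,q)$. $G$ is $d$-stress-independent if $\{u,v\}$ is not $d$-stress-linked in $G-uv$ for every edge $uv$ of $G$. *)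

theory Defs
  imports Complex_Main "HOL-Library.Poly_Mapping" "HOL-Library.Ramsey"
begin

record 'a ugraph =
  verts :: "'a set"
  edges :: "'a set set"

definition simple_graph :: "'a ugraph \<Rightarrow> bool" where
  "simple_graph G \<longleftrightarrow> finite (verts G) \<and> edges G \<subseteq> nsets (verts G) 2"

definition subgraph_of :: "'a ugraph \<Rightarrow> 'a ugraph \<Rightarrow> bool" where
  "subgraph_of H G \<longleftrightarrow> simple_graph H \<and> verts H \<subseteq> verts G \<and> edges H \<subseteq> edges G"

definition is_complete_graph :: "nat \<Rightarrow> 'a ugraph \<Rightarrow> bool" where
  "is_complete_graph n G \<longleftrightarrow> card (verts G) = n \<and> edges G = nsets (verts G) 2"

definition add_edge :: "'a ugraph \<Rightarrow> 'a \<Rightarrow> 'a \<Rightarrow> 'a ugraph" where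
  "add_edge G u v = G\<lparr>edges := insert {u, v} (edges G)\<rparr>"

definition del_edge :: "'a ugraph \<Rightarrow> 'a \<Rightarrow> 'a \<Rightarrow> 'a ugraph" where
  "del_edge G u v = G\<lparr>edges := edges G - {{u, v}}\<rparr>"

text \<open>
  A polynomial over the rationals in variables of type \<open>'i\<close> is a finitely supported
  map from monomials to coefficients; a monomial is a finitely supported exponent map.
\<close>

definition eval_mpoly :: "('i \<Rightarrow> real) \<Rightarrow> (('i \<Rightarrow>\<^sub>0 nat) \<Rightarrow>\<^sub>0 rat) \<Rightarrow> real" where
  "eval_mpoly x P =
     (\<Sum>m\<in>Poly_Mapping.keys P. of_rat (Poly_Mapping.lookup P m) *
        (\<Prod>i\<in>Poly_Mapping.keys m. x i ^ Poly_Mapping.lookup m i))"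

definition alg_independent :: "'i set \<Rightarrow> ('i \<Rightarrow> real) \<Rightarrow> bool" where
  "alg_independent I x \<longleftrightarrow>
     (\<forall>P. (\<forall>m\<in>Poly_Mapping.keys P. Poly_Mapping.keys m \<subseteq> I) \<and> eval_mpoly x P = 0 \<longrightarrow> P = 0)"

text \<open>
  Since two dimensions occur side by side, a framework of a graph in \<open>k\<close>-space
  is a map \<open>p\<close> for which \<open>p v i\<close>, with \<open>i < k\<close>, is the \<open>i\<close>-th coordinate of the
  vertex \<open>v\<close>. Every notion below looks only at the values with \<open>v\<close> a vertex and \<open>i < k\<close>.
\<close>

type_synonym 'a framework = "'a \<Rightarrow> nat \<Rightarrow> real"

definition generic :: "nat \<Rightarrow> 'a set \<Rightarrow> 'a framework \<Rightarrow> bool" where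
  "generic k V p \<longleftrightarrow> alg_independent (V \<times> {..<k}) (\<lambda>(v, i). p v i)"

text \<open>
  Entry in the row of edge \<open>e\<close> and the \<open>i\<close>-th column of vertex \<open>v\<close>.
  If \<open>v\<close> is an endpoint of \<open>e\<close>, then \<open>e - {v}\<close> consists of the other endpoint only,
  so that the sum has a single term.
\<close>

definition rigidity_matrix :: "'a framework \<Rightarrow> 'a set \<Rightarrow> 'a \<Rightarrow> nat \<Rightarrow> real" where
  "rigidity_matrix p e v i = (if v \<in> e then \<Sum>w\<in>e - {v}. p v i - p w i else 0)"

definition rows_independent :: "nat \<Rightarrow> 'a set \<Rightarrow> 'a framework \<Rightarrow> 'a set set \<Rightarrow> bool" where
  "rows_independent k V p F \<longleftrightarrow>
     (\<forall>c :: 'a set \<Rightarrow> real.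
        (\<forall>v\<in>V. \<forall>i<k. (\<Sum>e\<in>F. c e * rigidity_matrix p e v i) = 0) \<longrightarrow> (\<forall>e\<in>F. c e = 0))"

text \<open>
  The row matroid is the same for all generic frameworks, so one of them is chosen
  to define the generic rigidity matroid.
\<close>

definition generic_framework :: "nat \<Rightarrow> 'a set \<Rightarrow> 'a framework" where
  "generic_framework k V = (SOME p. generic k V p)"

definition rigidity_indep_set :: "nat \<Rightarrow> 'a ugraph \<Rightarrow> 'a set set \<Rightarrow> bool" where
  "rigidity_indep_set k G F \<longleftrightarrow>
     F \<subseteq> edges G \<and> rows_independent k (verts G) (generic_framework k (verts G)) F"

definition rigidity_rank :: "nat \<Rightarrow> 'a ugraph \<Rightarrow> nat" where
  "rigidity_rank k G = Max {card F |F. rigidity_indep_set k G F}"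

definition rigidity_independent :: "nat \<Rightarrow> 'a ugraph \<Rightarrow> bool" where
  "rigidity_independent k G \<longleftrightarrow> rigidity_indep_set k G (edges G)"

definition linked :: "nat \<Rightarrow> 'a ugraph \<Rightarrow> 'a \<Rightarrow> 'a \<Rightarrow> bool" where
  "linked d G u v \<longleftrightarrow>
     u \<in> verts G \<and> v \<in> verts G \<and> u \<noteq> v \<and>
     rigidity_rank d (add_edge G u v) = rigidity_rank d G"

text \<open>
  An element of \<open>\<real>\<^sup>E\<close> is represented by a function that vanishes outside \<open>E\<close>.
\<close>

definition stresses :: "nat \<Rightarrow> 'a ugraph \<Rightarrow> 'a framework \<Rightarrow> ('a set \<Rightarrow> real) set" where
  "stresses d G p =
     {\<omega>. (\<forall>e. e \<notin> edges G \<longrightarrow> \<omega> e = 0) \<and>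
         (\<forall>y\<in>verts G. \<forall>i<d. (\<Sum>x | {x, y} \<in> edges G. \<omega> {x, y} * (p x i - p y i)) = 0)}"

definition stress_linked :: "nat \<Rightarrow> 'a ugraph \<Rightarrow> 'a \<Rightarrow> 'a \<Rightarrow> bool" where
  "stress_linked d G u v \<longleftrightarrow>
     linked d G u v \<and>
     (\<forall>p q. generic d (verts G) p \<and> stresses d G p \<subseteq> stresses d G q \<longrightarrow>
        stresses d (add_edge G u v) p \<subseteq> stresses d (add_edge G u v) q)"

definition stress_independent :: "nat \<Rightarrow> 'a ugraph \<Rightarrow> bool" where
  "stress_independent d G \<longleftrightarrow>
     (\<forall>u v. {u, v} \<in> edges G \<longrightarrow> \<not> stress_linked d (del_edge G u v) u v)"

end

theory Submission
  imports Defs "HOL-Computational_Algebra.Polynomial"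
    "HOL-Analysis.Continuum_Not_Denumerable" "HOL-Analysis.Finite_Cartesian_Product"
begin

text \<open>
  A stress \<open>\<omega>\<close> acts on functions on the vertices as a symmetric matrix. If an edge \<open>uv\<close> carried a
  stress \<open>\<eta>\<close> of a generic framework \<open>(p, h)\<close> in dimension \<open>d + 1\<close>, and all stresses of \<open>(G - uv, p)\<close>
  annihilated \<open>g\<close>, then for a stress \<open>\<omega>\<close> of \<open>(G, p)\<close> the vector \<open>\<omega> g\<close> would be a multiple of \<open>\<eta> g\<close>,
  which is orthogonal to \<open>h\<close> because \<open>\<eta> h = 0\<close>. As \<open>h\<close> varies this forces \<open>\<omega> g = 0\<close>, so \<open>uv\<close> would be
  \<open>d\<close>-stress-linked in \<open>G - uv\<close>. This gives (a).

  By (a), for a generic \<open>h\<close> the map \<open>\<omega> \<mapsto> \<omega> h\<close> is injective on the stresses of \<open>(G', p)\<close>, and its values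
  are orthogonal to \<open>1\<close> and the coordinates of \<open>p\<close>, so that there are at most \<open>|V'| - d - 1\<close>
  independent stresses. In the case of equality, each stressed edge \<open>e\<close> comes with a
  vector \<open>h\<close> that is annihilated by exactly the stresses vanishing on \<open>e\<close>; these vectors diagonalise
  the stress space, whence the fundamental stresses have rank one and edge-disjoint complete graphs
  on at least \<open>d + 2\<close> vertices as supports. By the rank bound there is only one of them.
\<close>

section \<open>Rational polynomials at generic points\<close>

text \<open>The obstacle is genericity. For each edge, the failure of stress-linkedness is witnessed
  at some generic point of its own, whereas the count needs the witnesses of all edges at one point
  \<open>p\<close>; and ranks refer to one framework picked by \<open>SOME\<close>. Whatever has to
  move from one generic point to another is therefore written as a solution of a linear system with
  polynomial entries: such a system has a spanning family of solutions that is polynomial in the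
  point, and a polynomial that is nonzero somewhere is nonzero at every generic point.

  The map \<omega> \<mapsto> \<omega> h is injective because a stress of \<open>p\<close> that also
  annihilates \<open>h\<close> is a stress of (p, h) in dimension d + 1. In the equality case with m
  independent stresses there are m + d + 1 vertices, and m disjoint cliques fit under the rank bound
  only if m d \<le> d.\<close>

definition qpolyfun :: "'i set \<Rightarrow> (('i \<Rightarrow> real) \<Rightarrow> real) \<Rightarrow> bool" where
  "qpolyfun I f \<longleftrightarrow>
     (\<exists>P. (\<forall>m\<in>Poly_Mapping.keys P. Poly_Mapping.keys m \<subseteq> I) \<and> f = (\<lambda>x. eval_mpoly x P))"

definition monom_eval :: "('i \<Rightarrow> real) \<Rightarrow> ('i \<Rightarrow>\<^sub>0 nat) \<Rightarrow> real" where
  "monom_eval x m = (\<Prod>i\<in>Poly_Mapping.keys m. x i ^ Poly_Mapping.lookup m i)"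

lemma monom_eval_superset:
  assumes "finite A" "Poly_Mapping.keys m \<subseteq> A"
  shows "monom_eval x m = (\<Prod>i\<in>A. x i ^ Poly_Mapping.lookup m i)"
  unfolding monom_eval_def
  by (rule prod.mono_neutral_left) (use assms in \<open>auto simp: in_keys_iff\<close>)

lemma monom_eval_add: "monom_eval x (m + n) = monom_eval x m * monom_eval x n"
proof -
  let ?A = "Poly_Mapping.keys m \<union> Poly_Mapping.keys n"
  have "Poly_Mapping.keys (m + n) \<subseteq> ?A"
    by (rule Poly_Mapping.keys_add)
  then show ?thesis
    by (simp add: monom_eval_superset[where A = ?A] lookup_add power_add prod.distrib)
qed

lemma eval_mpoly_superset:
  assumes "finite A" "Poly_Mapping.keys P \<subseteq> A"
  shows "eval_mpoly x P = (\<Sum>m\<in>A. of_rat (Poly_Mapping.lookup P m) * monom_eval x m)"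
  unfolding eval_mpoly_def monom_eval_def
  by (rule sum.mono_neutral_left) (use assms in \<open>auto simp: in_keys_iff\<close>)

lemma eval_mpoly_add: "eval_mpoly x (P + Q) = eval_mpoly x P + eval_mpoly x Q"
proof -
  let ?A = "Poly_Mapping.keys P \<union> Poly_Mapping.keys Q"
  have "Poly_Mapping.keys (P + Q) \<subseteq> ?A"
    by (rule Poly_Mapping.keys_add)
  then show ?thesis
    by (simp add: eval_mpoly_superset[where A = ?A] lookup_add of_rat_add distrib_right sum.distrib)
qed

lemma eval_mpoly_single:
  "eval_mpoly x (Poly_Mapping.single m a) = of_rat a * monom_eval x m"
  by (subst eval_mpoly_superset[where A = "{m}"]) auto

lemma eval_mpoly_zero [simp]: "eval_mpoly x 0 = 0"
  by (simp add: eval_mpoly_def)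

lemma qpolyfun_monom:
  "Poly_Mapping.keys m \<subseteq> I \<Longrightarrow> qpolyfun I (\<lambda>x. of_rat a * monom_eval x m)"
  unfolding qpolyfun_def
  by (intro exI[of _ "Poly_Mapping.single m a"]) (auto simp: eval_mpoly_single split: if_splits)

lemma qpolyfun_const: "qpolyfun I (\<lambda>x. of_rat a)"
  using qpolyfun_monom[of 0 I a] by (simp add: monom_eval_def)

lemma qpolyfun_0 [simp]: "qpolyfun I (\<lambda>x. 0)"
  and qpolyfun_1 [simp]: "qpolyfun I (\<lambda>x. 1)"
  using qpolyfun_const[of I 0] qpolyfun_const[of I 1] by simp_all

lemma qpolyfun_var: "i \<in> I \<Longrightarrow> qpolyfun I (\<lambda>x. x i)"
  using qpolyfun_monom[of "Poly_Mapping.single i 1" I 1] by (simp add: monom_eval_def)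

lemma qpolyfun_add:
  assumes "qpolyfun I f" "qpolyfun I g"
  shows "qpolyfun I (\<lambda>x. f x + g x)"
proof -
  obtain P Q where
    "\<forall>m\<in>Poly_Mapping.keys P. Poly_Mapping.keys m \<subseteq> I" "f = (\<lambda>x. eval_mpoly x P)"
    "\<forall>m\<in>Poly_Mapping.keys Q. Poly_Mapping.keys m \<subseteq> I" "g = (\<lambda>x. eval_mpoly x Q)"
    using assms unfolding qpolyfun_def by blast
  then show ?thesis
    unfolding qpolyfun_def using Poly_Mapping.keys_add[of P Q]
    by (intro exI[of _ "P + Q"]) (auto simp: eval_mpoly_add)
qed

lemma qpolyfun_sum:
  "(\<And>a. a \<in> A \<Longrightarrow> qpolyfun I (f a)) \<Longrightarrow> qpolyfun I (\<lambda>x. \<Sum>a\<in>A. f a x)"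
proof (induction A rule: infinite_finite_induct)
  case (insert a A)
  then show ?case using qpolyfun_add[of I "f a" "\<lambda>x. sum (\<lambda>a. f a x) A"] by simp
qed simp_all

lemma qpolyfun_mult:
  assumes "qpolyfun I f" "qpolyfun I g"
  shows "qpolyfun I (\<lambda>x. f x * g x)"
proof -
  obtain P Q where P: "\<forall>m\<in>Poly_Mapping.keys P. Poly_Mapping.keys m \<subseteq> I"
    and f: "f = (\<lambda>x. eval_mpoly x P)"
    and Q: "\<forall>m\<in>Poly_Mapping.keys Q. Poly_Mapping.keys m \<subseteq> I"
    and g: "g = (\<lambda>x. eval_mpoly x Q)"
    using assms unfolding qpolyfun_def by blast
  have "f x * g x = (\<Sum>m\<in>Poly_Mapping.keys P. \<Sum>n\<in>Poly_Mapping.keys Q.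
      of_rat (Poly_Mapping.lookup P m * Poly_Mapping.lookup Q n) * monom_eval x (m + n))" for x
    unfolding f g eval_mpoly_def monom_eval_def[symmetric] sum_product monom_eval_add of_rat_mult
    by (simp add: mult.assoc mult.left_commute)
  then have eq: "(\<lambda>x. f x * g x) = (\<lambda>x. \<Sum>m\<in>Poly_Mapping.keys P. \<Sum>n\<in>Poly_Mapping.keys Q.
      of_rat (Poly_Mapping.lookup P m * Poly_Mapping.lookup Q n) * monom_eval x (m + n))"
    by auto
  show ?thesis
    unfolding eq
  proof (rule qpolyfun_sum, rule qpolyfun_sum, rule qpolyfun_monom)
    fix m n assume "m \<in> Poly_Mapping.keys P" "n \<in> Poly_Mapping.keys Q"
    then show "Poly_Mapping.keys (m + n) \<subseteq> I"
      using P Q Poly_Mapping.keys_add[of m n] by blast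
  qed
qed

lemma qpolyfun_diff:
  assumes "qpolyfun I f" "qpolyfun I g"
  shows "qpolyfun I (\<lambda>x. f x - g x)"
  using qpolyfun_add[of I f "\<lambda>x. of_rat (-1) * g x"]
    qpolyfun_mult[of I "\<lambda>x. of_rat (-1)" g] qpolyfun_const[of I "-1"] assms by simp

lemma qpolyfun_power: "qpolyfun I f \<Longrightarrow> qpolyfun I (\<lambda>x. f x ^ n)"
  by (induction n) (simp_all add: qpolyfun_mult)

lemma qpolyfun_prod:
  "(\<And>a. a \<in> A \<Longrightarrow> qpolyfun I (f a)) \<Longrightarrow> qpolyfun I (\<lambda>x. \<Prod>a\<in>A. f a x)"
proof (induction A rule: infinite_finite_induct)
  case (insert a A)
  then show ?case using qpolyfun_mult[of I "f a" "\<lambda>x. prod (\<lambda>a. f a x) A"] by simp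
qed simp_all

text \<open>Used in the contrapositive: a polynomial function that is nonzero at a single point
  \<open>y\<close>, generic or not, is nonzero at every generic \<open>x\<close>. All transfers
  between generic frameworks rest on this.\<close>

lemma alg_independent_vanishing:
  assumes "alg_independent I x" "qpolyfun I f" "f x = 0"
  shows "f y = 0"
  using assms unfolding alg_independent_def qpolyfun_def by fastforce

lemma alg_independent_subset: "alg_independent I x \<Longrightarrow> J \<subseteq> I \<Longrightarrow> alg_independent J x"
  unfolding alg_independent_def by blast

lemma eval_mpoly_cong:
  assumes "\<forall>m\<in>Poly_Mapping.keys P. Poly_Mapping.keys m \<subseteq> I" "\<And>i. i \<in> I \<Longrightarrow> x i = y i"
  shows "eval_mpoly x P = eval_mpoly y P"
proof -
  have "x i = y i" if "m \<in> Poly_Mapping.keys P" "i \<in> Poly_Mapping.keys m" for m i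
    using assms that by blast
  then show ?thesis
    unfolding eval_mpoly_def by (intro sum.cong prod.cong arg_cong2[where f = "(*)"]) simp_all
qed

lemma alg_independent_cong:
  assumes "\<And>i. i \<in> I \<Longrightarrow> x i = y i"
  shows "alg_independent I x \<longleftrightarrow> alg_independent I y"
  unfolding alg_independent_def using eval_mpoly_cong[of _ I x y] assms by metis

text \<open>
  If \<open>P\<close> vanishes at the shifted point, then \<open>P\<close> composed with the shift is a polynomial
  that vanishes at \<open>x\<close>, hence everywhere.
\<close>

lemma alg_independent_shift:
  assumes x: "alg_independent I x"
  shows "alg_independent I (x(j := x j + 1))"
  unfolding alg_independent_def
proof (intro allI impI, elim conjE)
  fix P :: "('a \<Rightarrow>\<^sub>0 nat) \<Rightarrow>\<^sub>0 rat"
  assume P: "\<forall>m\<in>Poly_Mapping.keys P. Poly_Mapping.keys m \<subseteq> I"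
    and 0: "eval_mpoly (x(j := x j + 1)) P = 0"
  let ?f = "\<lambda>y. eval_mpoly (y(j := y j + 1)) P"
  have var: "qpolyfun I (\<lambda>y. (y(j := y j + 1)) i)" if "i \<in> I" for i
    using that qpolyfun_add[of I "\<lambda>y. y j" "\<lambda>y. 1"] qpolyfun_var[of j I] qpolyfun_var[of i I]
    by (cases "i = j") simp_all
  have mon: "qpolyfun I (\<lambda>y. monom_eval (y(j := y j + 1)) m)" if "m \<in> Poly_Mapping.keys P" for m
    unfolding monom_eval_def
    by (rule qpolyfun_prod, rule qpolyfun_power, rule var) (use P that in auto)
  have "qpolyfun I ?f"
    unfolding eval_mpoly_def monom_eval_def[symmetric]
    by (rule qpolyfun_sum, rule qpolyfun_mult, rule qpolyfun_const, rule mon)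
  \<comment> \<open>The shift takes this point to \<open>x\<close>, so \<open>P\<close> itself
    vanishes at \<open>x\<close>.\<close>
  then have "?f (x(j := x j - 1)) = 0"
    using alg_independent_vanishing[where f = ?f] x 0 by blast
  then have "eval_mpoly x P = 0" by simp
  then show "P = 0"
    using x P unfolding alg_independent_def by blast
qed

section \<open>Existence of generic points\<close>

lemma countable_mpolys:
  assumes "finite I"
  shows "countable {P :: ('i \<Rightarrow>\<^sub>0 nat) \<Rightarrow>\<^sub>0 rat.
    \<forall>m\<in>Poly_Mapping.keys P. Poly_Mapping.keys m \<subseteq> I}" (is "countable ?Ps")
proof -
  let ?M = "{m :: 'i \<Rightarrow>\<^sub>0 nat. Poly_Mapping.keys m \<subseteq> I}"
  have "inj_on (\<lambda>m. restrict (Poly_Mapping.lookup m) I) ?M"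
  proof (rule inj_onI, rule poly_mapping_eqI)
    fix m n :: "'i \<Rightarrow>\<^sub>0 nat" and k
    assume "m \<in> ?M" "n \<in> ?M"
      and eq: "restrict (Poly_Mapping.lookup m) I = restrict (Poly_Mapping.lookup n) I"
    then have "k \<notin> I \<Longrightarrow> Poly_Mapping.lookup m k = 0 \<and> Poly_Mapping.lookup n k = 0"
      by (auto simp: in_keys_iff)
    then show "Poly_Mapping.lookup m k = Poly_Mapping.lookup n k"
      using fun_cong[OF eq, of k] by (cases "k \<in> I") auto
  qed
  moreover have "(\<lambda>m. restrict (Poly_Mapping.lookup m) I) ` ?M \<subseteq> (\<Pi>\<^sub>E i\<in>I. UNIV)"
    by auto
  moreover have "countable (\<Pi>\<^sub>E i\<in>I. (UNIV :: nat set))"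
    using assms by (intro countable_PiE) auto
  ultimately have M: "countable ?M"
    by (meson countable_subset countable_image_inj_on)
  let ?graph = "\<lambda>P :: ('i \<Rightarrow>\<^sub>0 nat) \<Rightarrow>\<^sub>0 rat.
    (\<lambda>m. (m, Poly_Mapping.lookup P m)) ` Poly_Mapping.keys P"
  have "inj_on ?graph ?Ps"
  proof (rule inj_onI, rule poly_mapping_eqI)
    fix P Q :: "('i \<Rightarrow>\<^sub>0 nat) \<Rightarrow>\<^sub>0 rat" and m
    assume "?graph P = ?graph Q"
    then have "(m, a) \<in> ?graph P \<longleftrightarrow> (m, a) \<in> ?graph Q" for a by simp
    then have "a \<noteq> 0 \<Longrightarrow> a = Poly_Mapping.lookup P m \<longleftrightarrow> a = Poly_Mapping.lookup Q m" for a
      by (fastforce simp: image_iff in_keys_iff)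
    then show "Poly_Mapping.lookup P m = Poly_Mapping.lookup Q m"
      by metis
  qed
  moreover have "?graph ` ?Ps \<subseteq> {A. finite A \<and> A \<subseteq> ?M \<times> UNIV}"
    by auto
  moreover have "countable {A. finite A \<and> A \<subseteq> ?M \<times> (UNIV :: rat set)}"
    using M by (intro countable_Collect_finite_subset countable_SIGMA) auto
  ultimately show ?thesis
    by (meson countable_subset countable_image_inj_on)
qed

text \<open>
  Seen as a polynomial in the variable \<open>j\<close> alone, a nonzero \<open>P\<close> has a nonzero coefficient,
  which does not vanish at \<open>x\<close>.
\<close>

lemma finite_roots_new_variable:
  assumes x: "alg_independent I x" and j: "j \<notin> I"
    and P: "\<forall>m\<in>Poly_Mapping.keys P. Poly_Mapping.keys m \<subseteq> insert j I" and "P \<noteq> 0"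
  shows "finite {t. eval_mpoly (x(j := t)) P = 0}"
proof -
  let ?K = "Poly_Mapping.keys P"
  let ?l = "Poly_Mapping.lookup"
  define rem where "rem m = m - Poly_Mapping.single j (?l m j)" for m :: "'a \<Rightarrow>\<^sub>0 nat"
  have rem_l: "?l (rem m) i = (if i = j then 0 else ?l m i)" for m i
    by (auto simp: rem_def lookup_minus lookup_single)
  have split: "monom_eval (x(j := t)) m = t ^ ?l m j * monom_eval x (rem m)" for t m
  proof -
    have *: "Poly_Mapping.keys (rem m) = Poly_Mapping.keys m - {j}"
      by (auto simp: in_keys_iff rem_l split: if_splits)
    have "monom_eval (x(j := t)) m =
        (\<Prod>i\<in>insert j (Poly_Mapping.keys m - {j}). (x(j := t)) i ^ ?l m i)"
      by (rule monom_eval_superset) auto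
    also have "\<dots> = t ^ ?l m j * (\<Prod>i\<in>Poly_Mapping.keys m - {j}. (x(j := t)) i ^ ?l m i)"
      by (subst prod.insert) auto
    also have "(\<Prod>i\<in>Poly_Mapping.keys m - {j}. (x(j := t)) i ^ ?l m i) = monom_eval x (rem m)"
      unfolding monom_eval_def * by (rule prod.cong) (auto simp: rem_l)
    finally show ?thesis .
  qed
  define c where "c k = (\<Sum>m\<in>{m\<in>?K. ?l m j = k}. of_rat (?l P m) * monom_eval x (rem m))" for k
  define R where "R = (\<Sum>m\<in>?K. monom (of_rat (?l P m) * monom_eval x (rem m)) (?l m j))"
  have coeff_R: "coeff R k = c k" for k
    unfolding R_def c_def coeff_sum coeff_monom
    by (subst sum.inter_filter) (auto intro: sum.cong)
  have R: "poly R t = eval_mpoly (x(j := t)) P" for t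
    unfolding R_def poly_sum poly_monom eval_mpoly_def monom_eval_def[symmetric] split
    by (simp add: mult_ac)
  have "c k \<noteq> 0" if m0: "m0 \<in> ?K" "?l m0 j = k" for m0 k
  proof
    define Pk where "Pk = (\<Sum>m\<in>{m\<in>?K. ?l m j = k}. Poly_Mapping.single (rem m) (?l P m))"
    have "eval_mpoly x Pk = (\<Sum>m\<in>{m\<in>?K. ?l m j = k}. eval_mpoly x (Poly_Mapping.single (rem m) (?l P m)))"
      unfolding Pk_def by (induction rule: infinite_finite_induct) (auto simp: eval_mpoly_add)
    then have "eval_mpoly x Pk = c k"
      by (simp add: c_def eval_mpoly_single)
    moreover have "\<forall>m\<in>Poly_Mapping.keys Pk. Poly_Mapping.keys m \<subseteq> I"
    proof
      fix n assume "n \<in> Poly_Mapping.keys Pk"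
      then have "?l Pk n \<noteq> 0" by (simp add: in_keys_iff)
      then obtain m where "m \<in> ?K" "?l (Poly_Mapping.single (rem m) (?l P m)) n \<noteq> 0"
        unfolding Pk_def lookup_sum by (metis (no_types, lifting) mem_Collect_eq sum.neutral)
      then have "n = rem m" "Poly_Mapping.keys m \<subseteq> insert j I"
        using P by (auto simp: lookup_single when_def split: if_splits)
      moreover have "Poly_Mapping.keys (rem m) \<subseteq> Poly_Mapping.keys m - {j}"
        by (auto simp: in_keys_iff rem_l split: if_splits)
      ultimately show "Poly_Mapping.keys n \<subseteq> I" by blast
    qed
    moreover assume "c k = 0"
    ultimately have "Pk = 0" using x unfolding alg_independent_def by auto
    moreover have "?l Pk (rem m0) = ?l P m0"
    proof -
      \<comment> \<open>Within one power of the variable \<open>j\<close>, \<open>rem\<close> is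
        injective, so no coefficients merge in \<open>Pk\<close> and the one at
        \<open>rem m0\<close> stays nonzero.\<close>
      have "rem m = rem m0 \<longleftrightarrow> m = m0" if "?l m j = k" for m
        using that m0(2) by (metis poly_mapping_eqI rem_l)
      then have "?l Pk (rem m0) = (\<Sum>m\<in>{m\<in>?K. ?l m j = k}. if m = m0 then ?l P m else 0)"
        unfolding Pk_def lookup_sum by (intro sum.cong) (auto simp: lookup_single)
      then show ?thesis using m0 by simp
    qed
    ultimately show False using m0 by (auto simp: in_keys_iff)
  qed
  moreover obtain m0 where "m0 \<in> ?K"
    using \<open>P \<noteq> 0\<close> by (metis keys_eq_empty ex_in_conv)
  ultimately have "R \<noteq> 0" using coeff_R by (metis coeff_0)
  then show ?thesis
    using poly_roots_finite[of R] by (simp add: R)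
qed

text \<open>A value \<open>t\<close> is bad if some nonzero rational polynomial over
  \<open>insert j I\<close> vanishes there. There are countably many such polynomials, each excludes
  finitely many \<open>t\<close>, and the reals are uncountable.\<close>

lemma alg_independent_insert:
  assumes x: "alg_independent I x" and I: "finite I" and j: "j \<notin> I"
  shows "\<exists>t. alg_independent (insert j I) (x(j := t))"
proof -
  let ?Ps = "{P :: ('a \<Rightarrow>\<^sub>0 nat) \<Rightarrow>\<^sub>0 rat.
    \<forall>m\<in>Poly_Mapping.keys P. Poly_Mapping.keys m \<subseteq> insert j I}"
  have "countable (\<Union>P\<in>?Ps - {0}. {t. eval_mpoly (x(j := t)) P = 0})"
  proof (rule countable_UN)
    show "countable (?Ps - {0})"
      using countable_mpolys[of "insert j I"] I by (intro countable_Diff) simp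
    fix P assume "P \<in> ?Ps - {0}"
    then show "countable {t. eval_mpoly (x(j := t)) P = 0}"
      by (intro countable_finite finite_roots_new_variable[OF x j]) auto
  qed
  moreover have "\<exists>t. t \<notin> A" if "countable A" for A :: "real set"
    using that uncountable_UNIV_real by (metis UNIV_eq_I)
  ultimately obtain t where "t \<notin> (\<Union>P\<in>?Ps - {0}. {t. eval_mpoly (x(j := t)) P = 0})"
    by presburger
  then have t: "\<forall>P\<in>?Ps - {0}. eval_mpoly (x(j := t)) P \<noteq> 0"
    by simp
  have "alg_independent (insert j I) (x(j := t))"
    unfolding alg_independent_def
  proof (intro allI impI, elim conjE, rule ccontr)
    fix P :: "('a \<Rightarrow>\<^sub>0 nat) \<Rightarrow>\<^sub>0 rat"
    assume "\<forall>m\<in>Poly_Mapping.keys P. Poly_Mapping.keys m \<subseteq> insert j I"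
      and 0: "eval_mpoly (x(j := t)) P = 0" and "P \<noteq> 0"
    then have "P \<in> ?Ps - {0}" by simp
    from bspec[OF t this] 0 show False by simp
  qed
  then show ?thesis ..
qed

lemma alg_independent_extend:
  assumes "finite J" and "alg_independent I x" and "finite I"
  shows "\<exists>y. alg_independent (I \<union> J) y \<and> (\<forall>i\<in>I. y i = x i)"
  using assms(1)
proof (induction J rule: finite_induct)
  case empty
  then show ?case using assms(2) by auto
next
  case (insert j J)
  then obtain y where y: "alg_independent (I \<union> J) y" "\<forall>i\<in>I. y i = x i" by blast
  show ?case
  proof (cases "j \<in> I")
    case True
    then have "I \<union> insert j J = I \<union> J" by auto
    then show ?thesis using y by auto
  next
    case False
    then obtain t where "alg_independent (insert j (I \<union> J)) (y(j := t))"
      using alg_independent_insert[OF y(1), of j] insert assms(3) by auto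
    moreover have "(y(j := t)) i = x i" if "i \<in> I" for i
      using that y(2) False by auto
    ultimately show ?thesis by (metis Un_insert_right)
  qed
qed

lemma alg_independent_empty: "alg_independent {} x"
  unfolding alg_independent_def
proof (intro allI impI, elim conjE)
  fix P :: "('a \<Rightarrow>\<^sub>0 nat) \<Rightarrow>\<^sub>0 rat"
  assume "\<forall>m\<in>Poly_Mapping.keys P. Poly_Mapping.keys m \<subseteq> {}" and 0: "eval_mpoly x P = 0"
  then have "Poly_Mapping.keys P \<subseteq> {0}" by auto
  moreover from this have "Poly_Mapping.lookup P 0 = 0"
    using 0 eval_mpoly_superset[of "{0}" P x] by (simp add: monom_eval_def)
  ultimately have "Poly_Mapping.keys P = {}"
    by (metis in_keys_iff subset_singletonD singletonI)
  then show "P = 0" by simp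
qed

section \<open>Linear algebra\<close>

text \<open>The vectors form a family indexed by \<open>I\<close>, so that repetitions count as
  dependence. The coordinate set \<open>J\<close> is arbitrary, since vertices, vertex-coordinate
  pairs and numbers all serve as coordinates.\<close>

definition lin_indep :: "'i set \<Rightarrow> 'j set \<Rightarrow> ('i \<Rightarrow> 'j \<Rightarrow> real) \<Rightarrow> bool" where
  "lin_indep I J M \<longleftrightarrow>
     (\<forall>a. (\<forall>j\<in>J. (\<Sum>i\<in>I. a i * M i j) = 0) \<longrightarrow> (\<forall>i\<in>I. a i = 0))"

lemma lin_indep_subset:
  assumes "lin_indep I J M" "K \<subseteq> I" "finite I"
  shows "lin_indep K J M"
  unfolding lin_indep_def
proof (intro allI impI)
  fix a assume a: "\<forall>j\<in>J. (\<Sum>i\<in>K. a i * M i j) = 0"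
  have "(\<Sum>i\<in>I. (if i \<in> K then a i else 0) * M i j) = (\<Sum>i\<in>K. a i * M i j)" for j
    by (rule sum.mono_neutral_cong_right) (use assms(2,3) in auto)
  then have "\<forall>j\<in>J. (\<Sum>i\<in>I. (if i \<in> K then a i else 0) * M i j) = 0"
    using a by simp
  then have 0: "\<forall>i\<in>I. (if i \<in> K then a i else 0) = 0"
    using spec[OF assms(1)[unfolded lin_indep_def], of "\<lambda>i. if i \<in> K then a i else 0"] by blast
  show "\<forall>i\<in>K. a i = 0"
  proof
    fix i assume "i \<in> K"
    then show "a i = 0" using bspec[OF 0, of i] assms(2) by auto
  qed
qed

lemma lin_indep_single:
  assumes "j \<in> J" "x j \<noteq> 0"
  shows "lin_indep {k} J (\<lambda>_. x)"
  using assms unfolding lin_indep_def by auto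

text \<open>Elimination: a vector \<open>p\<close> with nonzero \<open>j\<close>-th coordinate
  clears that coordinate in all others, and what remains of them is still independent on
  \<open>J\<close>.\<close>

lemma lin_indep_card:
  assumes "finite J" "finite I" "lin_indep I J M"
  shows "card I \<le> card J"
  using assms
proof (induction J arbitrary: I M rule: finite_induct)
  case empty
  then have "\<forall>i\<in>I. (1 :: real) = 0"
    using spec[OF empty.prems(2)[unfolded lin_indep_def], of "\<lambda>i. 1"] by simp
  then show ?case by auto
next
  case (insert j J)
  show ?case
  proof (cases "\<forall>i\<in>I. M i j = 0")
    case True
    then have "lin_indep I J M"
      using insert.prems(2) unfolding lin_indep_def by simp
    then show ?thesis
      using insert.IH[OF insert.prems(1)] insert.hyps by (simp add: le_SucI)
  next
    case False
    then obtain p where p: "p \<in> I" "M p j \<noteq> 0" by auto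
    define N where "N i k = M i k - M i j / M p j * M p k" for i k
    have "lin_indep (I - {p}) J N"
      unfolding lin_indep_def
    proof (intro allI impI)
      fix a assume a: "\<forall>k\<in>J. (\<Sum>i\<in>I - {p}. a i * N i k) = 0"
      \<comment> \<open>The coefficient at the pivot collects the multiples of row \<open>p\<close>
        hidden in the \<open>N i\<close>, so that both combinations are the same vector.\<close>
      define b where "b = a(p := - (\<Sum>i\<in>I - {p}. a i * (M i j / M p j)))"
      have eq: "(\<Sum>i\<in>I. b i * M i k) = (\<Sum>i\<in>I - {p}. a i * N i k)" for k
      proof -
        have "(\<Sum>i\<in>I. b i * M i k) = b p * M p k + (\<Sum>i\<in>I - {p}. b i * M i k)"
          using p insert.prems(1) by (simp add: sum.remove)
        also have "(\<Sum>i\<in>I - {p}. b i * M i k) = (\<Sum>i\<in>I - {p}. a i * M i k)"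
          by (rule sum.cong) (auto simp: b_def)
        finally show ?thesis
          by (simp add: b_def N_def right_diff_distrib sum_subtractf sum_distrib_right mult.assoc)
      qed
      have "(\<Sum>i\<in>I. b i * M i k) = 0" if "k \<in> insert j J" for k
        using that a eq[of k] p by (auto simp: N_def)
      then have "\<forall>i\<in>I. b i = 0"
        using insert.prems(2) unfolding lin_indep_def by blast
      then show "\<forall>i\<in>I - {p}. a i = 0"
        by (auto simp: b_def split: if_splits)
    qed
    from insert.IH[OF _ this] have "card (I - {p}) \<le> card J"
      using insert.prems(1) by simp
    then show ?thesis
      using insert.hyps insert.prems(1) p by (simp add: card_Diff_singleton)
  qed
qed

text \<open>If a combination of both families vanishes, its \<open>A\<close> part \<open>u\<close>
  is minus its \<open>B\<close> part. Then \<open>u\<close> is orthogonal to itself, hence zero over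
  the reals, so the joint family is independent.\<close>

lemma lin_indep_orthogonal_card:
  assumes fin: "finite J" "finite A" "finite B"
    and M: "lin_indep A J M" and N: "lin_indep B J N"
    and orth: "\<And>a b. a \<in> A \<Longrightarrow> b \<in> B \<Longrightarrow> (\<Sum>j\<in>J. M a j * N b j) = 0"
  shows "card A + card B \<le> card J"
proof -
  let ?P = "case_sum M N"
  have "lin_indep (A <+> B) J ?P"
    unfolding lin_indep_def
  proof (intro allI impI)
    fix c assume "\<forall>j\<in>J. (\<Sum>i\<in>A <+> B. c i * ?P i j) = 0"
    then have 0: "(\<Sum>a\<in>A. c (Inl a) * M a j) = - (\<Sum>b\<in>B. c (Inr b) * N b j)" if "j \<in> J" for j
      using that fin by (auto simp: sum.Plus eq_neg_iff_add_eq_0)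
    define u where "u j = (\<Sum>a\<in>A. c (Inl a) * M a j)" for j
    have "(\<Sum>j\<in>J. u j * u j) = - (\<Sum>j\<in>J. u j * (\<Sum>b\<in>B. c (Inr b) * N b j))"
      unfolding sum_negf[symmetric]
    proof (rule sum.cong)
      fix j assume "j \<in> J"
      then show "u j * u j = - (u j * (\<Sum>b\<in>B. c (Inr b) * N b j))"
        using 0[of j] unfolding u_def[symmetric] by simp
    qed simp
    also have "(\<Sum>j\<in>J. u j * (\<Sum>b\<in>B. c (Inr b) * N b j)) =
        (\<Sum>j\<in>J. \<Sum>a\<in>A. \<Sum>b\<in>B. c (Inl a) * c (Inr b) * (M a j * N b j))"
      unfolding u_def sum_product by (intro sum.cong refl) (simp only: mult_ac)
    also have "\<dots> = (\<Sum>a\<in>A. \<Sum>b\<in>B. c (Inl a) * c (Inr b) * (\<Sum>j\<in>J. M a j * N b j))"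
      by (subst sum.swap, rule sum.cong[OF refl], subst sum.swap) (simp only: sum_distrib_left)
    also have "\<dots> = 0"
      using orth by simp
    finally have "\<forall>j\<in>J. u j = 0"
      using fin by (simp add: sum_nonneg_eq_0_iff)
    then have "\<forall>j\<in>J. (\<Sum>a\<in>A. c (Inl a) * M a j) = 0" "\<forall>j\<in>J. (\<Sum>b\<in>B. c (Inr b) * N b j) = 0"
      using 0 unfolding u_def by auto
    then have "\<forall>a\<in>A. c (Inl a) = 0" "\<forall>b\<in>B. c (Inr b) = 0"
      using spec[OF M[unfolded lin_indep_def], of "\<lambda>a. c (Inl a)"]
        spec[OF N[unfolded lin_indep_def], of "\<lambda>b. c (Inr b)"] by blast+
    then show "\<forall>i\<in>A <+> B. c i = 0" by auto
  qed
  from lin_indep_card[OF fin(1) _ this] show ?thesis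
    using fin by (simp add: card_Plus)
qed

section \<open>Kernels of polynomial matrices\<close>

lemma sum_mult_unit_vector:
  fixes f :: "'i \<Rightarrow> real"
  assumes "finite A" "k \<in> A"
  shows "(\<Sum>i\<in>A. f i * (if i = k then 1 else 0)) = f k"
    and "(\<Sum>i\<in>A. (if i = k then 1 else 0) * f i) = f k"
  using assms by (simp_all add: if_distrib[of "\<lambda>c. c * _"] if_distrib[of "\<lambda>c. _ * c"] cong: if_cong)

text \<open>A spanning family rather than a basis, with as many members as there are unknowns, so
  that elimination need not drop any. One polynomial family serves all generic points at once; this
  uniformity makes transfer possible.\<close>

definition kernel_basis ::
  "'i set \<Rightarrow> 'r set \<Rightarrow> 'j set \<Rightarrow> ('r \<Rightarrow> 'j \<Rightarrow> ('i \<Rightarrow> real) \<Rightarrow> real) \<Rightarrow>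
    ('j \<Rightarrow> 'j \<Rightarrow> ('i \<Rightarrow> real) \<Rightarrow> real) \<Rightarrow> bool" where
  "kernel_basis I R J M Z \<longleftrightarrow>
    (\<forall>i\<in>J. \<forall>j\<in>J. qpolyfun I (Z i j)) \<and>
    (\<forall>x z. alg_independent I x \<longrightarrow>
      (\<forall>r\<in>R. (\<Sum>j\<in>J. z j * M r j x) = 0) = (\<exists>a. \<forall>j\<in>J. z j = (\<Sum>i\<in>J. a i * Z i j x)))"

lemma kernel_basis_qpolyfun: "kernel_basis I R J M Z \<Longrightarrow> i \<in> J \<Longrightarrow> j \<in> J \<Longrightarrow> qpolyfun I (Z i j)"
  unfolding kernel_basis_def by blast

lemma kernel_basis_span:
  assumes "kernel_basis I R J M Z" "alg_independent I x"
  shows "(\<forall>r\<in>R. (\<Sum>j\<in>J. z j * M r j x) = 0) \<longleftrightarrow> (\<exists>a. \<forall>j\<in>J. z j = (\<Sum>i\<in>J. a i * Z i j x))"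
  using assms unfolding kernel_basis_def by simp

lemma kernel_basis_combination:
  assumes "kernel_basis I R J M Z" "alg_independent I x" "\<forall>j\<in>J. z j = (\<Sum>i\<in>J. a i * Z i j x)"
  shows "\<forall>r\<in>R. (\<Sum>j\<in>J. z j * M r j x) = 0"
proof -
  have "\<exists>a. \<forall>j\<in>J. z j = (\<Sum>i\<in>J. a i * Z i j x)"
    by (rule exI[of _ a]) (rule assms(3))
  then show ?thesis
    unfolding kernel_basis_span[OF assms(1,2)] .
qed

lemma kernel_basis_member:
  assumes Z: "kernel_basis I R J M Z" and x: "alg_independent I x"
    and "finite J" "i \<in> J" "r \<in> R"
  shows "(\<Sum>j\<in>J. Z i j x * M r j x) = 0"
proof -
  have "\<forall>j\<in>J. Z i j x = (\<Sum>k\<in>J. (if k = i then 1 else 0) * Z k j x)"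
    using assms(3,4) by (simp add: sum_mult_unit_vector)
  then have "\<forall>r\<in>R. (\<Sum>j\<in>J. Z i j x * M r j x) = 0"
    by (rule kernel_basis_combination[OF Z x])
  then show ?thesis using assms(5) by simp
qed

text \<open>
  Gaussian elimination on polynomial vectors: if \<open>Z\<close> spans the kernel of the rows treated so far
  and \<open>\<phi> i\<close> is the value of the next row on \<open>Z i\<close>, then \<open>\<phi> p * Z i - \<phi> i * Z p\<close> spans the new
  kernel wherever the pivot \<open>\<phi> p\<close> does not vanish; this is the case at all generic
  points if it is so at one of them.
\<close>

lemma polynomial_kernel_basis:
  assumes "finite R" "finite J" and "\<And>r j. r \<in> R \<Longrightarrow> j \<in> J \<Longrightarrow> qpolyfun I (M r j)"
  shows "\<exists>Z. kernel_basis I R J M Z"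
  using assms(1,3)
proof (induction R rule: finite_induct)
  case empty
  have "kernel_basis I {} J M (\<lambda>i j x. if j = i then 1 else 0)"
    unfolding kernel_basis_def
  proof (intro conjI ballI allI impI)
    fix i j :: 'b
    show "qpolyfun I (\<lambda>x. if j = i then 1 else 0)"
      by (cases "j = i") simp_all
  next
    fix x and z :: "'b \<Rightarrow> real"
    have "\<forall>j\<in>J. z j = (\<Sum>i\<in>J. z i * (if j = i then 1 else 0))"
      using assms(2) sum_mult_unit_vector(1)[of J _ z] by (simp add: eq_commute)
    then show "(\<forall>r\<in>{}. (\<Sum>j\<in>J. z j * M r j x) = 0) =
        (\<exists>a. \<forall>j\<in>J. z j = (\<Sum>i\<in>J. a i * (if j = i then 1 else 0)))"
      by (intro iffI exI[of _ z] ballI) simp_all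
  qed
  then show ?case by (intro exI[of _ "\<lambda>i j x. if j = i then 1 else 0"])
next
  case (insert r R)
  then obtain Z where Z: "kernel_basis I R J M Z" by auto
  define \<phi> where "\<phi> i x = (\<Sum>j\<in>J. Z i j x * M r j x)" for i x
  have \<phi>p: "qpolyfun I (\<phi> i)" if "i \<in> J" for i
  proof -
    have "qpolyfun I (\<lambda>x. \<Sum>j\<in>J. Z i j x * M r j x)"
      by (rule qpolyfun_sum, rule qpolyfun_mult)
        (use kernel_basis_qpolyfun[OF Z] insert.prems that in auto)
    then show ?thesis unfolding \<phi>_def .
  qed
  have lin: "(\<Sum>j\<in>J. z j * M r j x) = (\<Sum>i\<in>J. a i * \<phi> i x)"
    if "\<forall>j\<in>J. z j = (\<Sum>i\<in>J. a i * Z i j x)" for a z x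
  proof -
    have "(\<Sum>j\<in>J. z j * M r j x) = (\<Sum>j\<in>J. \<Sum>i\<in>J. a i * (Z i j x * M r j x))"
      by (rule sum.cong) (use that in \<open>auto simp: sum_distrib_right mult.assoc\<close>)
    also have "\<dots> = (\<Sum>i\<in>J. \<Sum>j\<in>J. a i * (Z i j x * M r j x))"
      by (rule sum.swap)
    finally show ?thesis
      by (simp add: \<phi>_def sum_distrib_left)
  qed
  show ?case
  proof (cases "\<exists>p\<in>J. \<exists>x. alg_independent I x \<and> \<phi> p x \<noteq> 0")
    case False
    \<comment> \<open>The new row vanishes on the old kernel at all generic points, so it imposes no
      condition.\<close>
    have "kernel_basis I (insert r R) J M Z"
      unfolding kernel_basis_def
    proof (intro conjI ballI allI impI)
      fix x z assume x: "alg_independent I x"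
      have "\<phi> i x = 0" if "i \<in> J" for i using False x that by blast
      then have "(\<Sum>j\<in>J. z j * M r j x) = 0" if "\<forall>j\<in>J. z j = (\<Sum>i\<in>J. a i * Z i j x)" for a
        using lin[OF that] by simp
      then show "(\<forall>r\<in>insert r R. (\<Sum>j\<in>J. z j * M r j x) = 0) =
          (\<exists>a. \<forall>j\<in>J. z j = (\<Sum>i\<in>J. a i * Z i j x))"
        using kernel_basis_span[OF Z x, of z] by auto
    qed (rule kernel_basis_qpolyfun[OF Z])
    then show ?thesis by (intro exI[of _ Z])
  next
    case True
    then obtain p x0 where p: "p \<in> J" and p0: "\<phi> p x0 \<noteq> 0" by blast
    have piv: "\<phi> p x \<noteq> 0" if "alg_independent I x" for x
      using alg_independent_vanishing[of I x "\<phi> p" x0] that \<phi>p[OF p] p0 by blast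
    define Y where "Y i j x = \<phi> p x * Z i j x - \<phi> i x * Z p j x" for i j x
    have comb: "(\<Sum>i\<in>J. a i * Y i j x) = \<phi> p x * (\<Sum>i\<in>J. a i * Z i j x) - (\<Sum>i\<in>J. a i * \<phi> i x) * Z p j x"
      for a j x
      unfolding Y_def by (simp add: right_diff_distrib sum_subtractf sum_distrib_left
          sum_distrib_right mult_ac)
    have "kernel_basis I (insert r R) J M Y"
      unfolding kernel_basis_def
    proof (intro conjI allI impI ballI)
      fix i j assume ij: "i \<in> J" "j \<in> J"
      have "qpolyfun I (\<lambda>x. \<phi> p x * Z i j x - \<phi> i x * Z p j x)"
        by (rule qpolyfun_diff; rule qpolyfun_mult)
          (use kernel_basis_qpolyfun[OF Z] p ij \<phi>p in auto)
      then show "qpolyfun I (Y i j)" unfolding Y_def .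
    next
      fix x z assume x: "alg_independent I x"
      show "(\<forall>r\<in>insert r R. (\<Sum>j\<in>J. z j * M r j x) = 0) =
          (\<exists>a. \<forall>j\<in>J. z j = (\<Sum>i\<in>J. a i * Y i j x))"
      proof
        assume L: "\<forall>r\<in>insert r R. (\<Sum>j\<in>J. z j * M r j x) = 0"
        then obtain a where a: "\<forall>j\<in>J. z j = (\<Sum>i\<in>J. a i * Z i j x)"
          using kernel_basis_span[OF Z x, of z] by auto
        have "(\<Sum>i\<in>J. a i * \<phi> i x) = 0"
          using lin[OF a] L by simp
        then have a\<phi>: "(\<Sum>i\<in>J. a i / \<phi> p x * \<phi> i x) = 0"
          by (simp add: sum_divide_distrib[symmetric])
        \<comment> \<open>Each \<open>Y i\<close> is the pivot times \<open>Z i\<close> plus a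
          multiple of \<open>Z p\<close>; these multiples cancel because the new row annihilates
          \<open>z\<close>.\<close>
        have "z j = (\<Sum>i\<in>J. a i / \<phi> p x * Y i j x)" if "j \<in> J" for j
        proof -
          have "(\<Sum>i\<in>J. a i / \<phi> p x * Y i j x) = \<phi> p x * (\<Sum>i\<in>J. a i / \<phi> p x * Z i j x)"
            by (simp only: comb a\<phi>)
          also have "\<dots> = (\<Sum>i\<in>J. a i * Z i j x)"
            unfolding sum_distrib_left by (rule sum.cong) (simp_all add: piv[OF x])
          finally show ?thesis using a that by simp
        qed
        then show "\<exists>a. \<forall>j\<in>J. z j = (\<Sum>i\<in>J. a i * Y i j x)"
          by (intro exI[of _ "\<lambda>i. a i / \<phi> p x"] ballI)
      next
        assume "\<exists>a. \<forall>j\<in>J. z j = (\<Sum>i\<in>J. a i * Y i j x)"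
        then obtain a where a: "\<forall>j\<in>J. z j = (\<Sum>i\<in>J. a i * Y i j x)" by blast
        define s where "s = (\<Sum>k\<in>J. a k * \<phi> k x)"
        \<comment> \<open>The coefficients of \<open>z\<close> with respect to \<open>Z\<close>: the
          multiples of \<open>Z p\<close> subtracted in the \<open>Y i\<close> add up to
          \<open>s\<close>.\<close>
        define b where "b i = \<phi> p x * a i - s * (if i = p then 1 else 0)" for i
        have b: "(\<Sum>i\<in>J. b i * f i) = \<phi> p x * (\<Sum>i\<in>J. a i * f i) - s * f p"
          for f :: "'b \<Rightarrow> real"
        proof -
          have "(\<Sum>i\<in>J. b i * f i) =
              (\<Sum>i\<in>J. \<phi> p x * (a i * f i) - s * ((if i = p then 1 else 0) * f i))"
            by (rule sum.cong) (auto simp: b_def left_diff_distrib)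
          then show ?thesis
            by (simp only: sum_subtractf sum_distrib_left[symmetric]
                sum_mult_unit_vector[OF assms(2) p])
        qed
        have zb: "\<forall>j\<in>J. z j = (\<Sum>i\<in>J. b i * Z i j x)"
          using a by (simp add: comb b s_def)
        have "\<forall>r\<in>R. (\<Sum>j\<in>J. z j * M r j x) = 0"
          by (rule kernel_basis_combination[OF Z x zb])
        moreover have "(\<Sum>j\<in>J. z j * M r j x) = 0"
          unfolding lin[OF zb] b by (simp add: s_def)
        ultimately show "\<forall>r\<in>insert r R. (\<Sum>j\<in>J. z j * M r j x) = 0" by simp
      qed
    qed
    then show ?thesis by (intro exI[of _ Y])
  qed
qed

text \<open>Some member of the polynomial spanning family has a \<open>k\<close>-th entry that is
  nonzero at \<open>x\<close>, hence at \<open>y\<close>. The new solution is that member evaluated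
  at \<open>y\<close>.\<close>

lemma kernel_transfer:
  assumes fin: "finite R" "finite J" and M: "\<And>r j. r \<in> R \<Longrightarrow> j \<in> J \<Longrightarrow> qpolyfun I (M r j)"
    and x: "alg_independent I x" and y: "alg_independent I y"
    and z: "\<forall>r\<in>R. (\<Sum>j\<in>J. z j * M r j x) = 0" and k: "k \<in> J" "z k \<noteq> 0"
  shows "\<exists>z. (\<forall>r\<in>R. (\<Sum>j\<in>J. z j * M r j y) = 0) \<and> z k \<noteq> 0"
proof -
  have "\<exists>Z. kernel_basis I R J M Z"
    by (rule polynomial_kernel_basis[OF fin]) (rule M)
  then obtain Z where Z: "kernel_basis I R J M Z" ..
  obtain a where "\<forall>j\<in>J. z j = (\<Sum>i\<in>J. a i * Z i j x)"
    using z unfolding kernel_basis_span[OF Z x] ..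
  then have "(\<Sum>i\<in>J. a i * Z i k x) \<noteq> 0" using k by simp
  then obtain i where i: "i \<in> J" "a i * Z i k x \<noteq> 0"
    using sum.neutral[of J "\<lambda>i. a i * Z i k x"] by auto
  then have "Z i k y \<noteq> 0"
    using alg_independent_vanishing[of I y "Z i k" x] y kernel_basis_qpolyfun[OF Z i(1) k(1)]
    by auto
  moreover have "\<forall>r\<in>R. (\<Sum>j\<in>J. Z i j y * M r j y) = 0"
    using kernel_basis_member[OF Z y fin(2) i(1)] by blast
  ultimately show ?thesis by (intro exI[of _ "\<lambda>j. Z i j y"]) simp
qed

section \<open>Stresses\<close>

lemma nsets_2_mem: "{x, y} \<in> nsets V 2 \<longleftrightarrow> x \<in> V \<and> y \<in> V \<and> x \<noteq> y"
  by (auto simp: nsets_def card_insert_if)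

lemma nsets_2_E:
  assumes "e \<in> nsets V 2"
  obtains x y where "e = {x, y}" "x \<in> V" "y \<in> V" "x \<noteq> y"
proof -
  have "card e = 2" using assms by (simp add: nsets_def)
  then obtain x y where e: "e = {x, y}" by (auto simp: card_2_iff)
  then show ?thesis using assms that[of x y] unfolding e nsets_2_mem by blast
qed

text \<open>Up to sign, the stress matrix (the Laplacian with edge weights \<omega>) applied to
  \<open>h\<close>. The term x = y is zero, so the sum may run over all of \<open>V\<close>.\<close>

definition stress_apply :: "'a set \<Rightarrow> ('a set \<Rightarrow> real) \<Rightarrow> ('a \<Rightarrow> real) \<Rightarrow> 'a \<Rightarrow> real" where
  "stress_apply V \<omega> h y = (\<Sum>x\<in>V. \<omega> {x, y} * (h x - h y))"

text \<open>Vertex set and edge set are separate arguments, so that stresses of various edge sets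
  can be compared on one vertex set without forming graphs.\<close>

definition is_stress :: "nat \<Rightarrow> 'a set \<Rightarrow> 'a set set \<Rightarrow> 'a framework \<Rightarrow> ('a set \<Rightarrow> real) \<Rightarrow> bool" where
  "is_stress k V F p \<omega> \<longleftrightarrow>
     (\<forall>e. e \<notin> F \<longrightarrow> \<omega> e = 0) \<and> (\<forall>y\<in>V. \<forall>i<k. stress_apply V \<omega> (\<lambda>x. p x i) y = 0)"

lemma stresses_eq:
  assumes "simple_graph G"
  shows "stresses d G p = {\<omega>. is_stress d (verts G) (edges G) p \<omega>}"
proof -
  have "(\<Sum>x | {x, y} \<in> edges G. \<omega> {x, y} * (p x i - p y i)) =
      stress_apply (verts G) \<omega> (\<lambda>x. p x i) y"
    if "\<forall>e. e \<notin> edges G \<longrightarrow> \<omega> e = 0" for \<omega> y i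
    unfolding stress_apply_def
    by (rule sum.mono_neutral_left) (use assms that in \<open>auto simp: simple_graph_def nsets_2_mem
      dest: subsetD\<close>)
  then show ?thesis
    unfolding stresses_def is_stress_def by auto
qed

lemma is_stress_apply:
  "is_stress k V F p \<omega> \<Longrightarrow> y \<in> V \<Longrightarrow> i < k \<Longrightarrow> stress_apply V \<omega> (\<lambda>x. p x i) y = 0"
  unfolding is_stress_def by simp

lemma is_stress_mono: "is_stress k V F p \<omega> \<Longrightarrow> F \<subseteq> F' \<Longrightarrow> is_stress k V F' p \<omega>"
  unfolding is_stress_def by blast

lemma is_stress_dim_mono: "is_stress k V F p \<omega> \<Longrightarrow> l \<le> k \<Longrightarrow> is_stress l V F p \<omega>"
  unfolding is_stress_def by auto

lemma is_stress_restrict: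
  assumes "is_stress k V F p \<omega>" "\<And>e. e \<in> F - F' \<Longrightarrow> \<omega> e = 0"
  shows "is_stress k V F' p \<omega>"
  using assms unfolding is_stress_def by blast

lemma stress_apply_cong:
  assumes "\<And>x. x \<in> V \<Longrightarrow> h x = g x" "y \<in> V"
  shows "stress_apply V \<omega> h y = stress_apply V \<omega> g y"
  unfolding stress_apply_def by (rule sum.cong) (simp_all add: assms)

lemma is_stress_cong:
  assumes "\<And>x i. x \<in> V \<Longrightarrow> i < k \<Longrightarrow> p x i = q x i"
  shows "is_stress k V F p \<omega> \<longleftrightarrow> is_stress k V F q \<omega>"
proof -
  have "stress_apply V \<omega> (\<lambda>x. p x i) y = stress_apply V \<omega> (\<lambda>x. q x i) y"
    if "y \<in> V" "i < k" for y i
    by (rule stress_apply_cong) (use assms that in auto)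
  then show ?thesis unfolding is_stress_def by auto
qed

lemma stress_apply_diff_scale:
  "stress_apply V (\<lambda>e. \<omega> e - s * \<eta> e) h y = stress_apply V \<omega> h y - s * stress_apply V \<eta> h y"
  unfolding stress_apply_def by (simp add: left_diff_distrib sum_subtractf sum_distrib_left mult.assoc)

lemma stress_apply_sum_stress:
  "stress_apply V (\<lambda>e. \<Sum>i\<in>A. a i * W i e) h y = (\<Sum>i\<in>A. a i * stress_apply V (W i) h y)"
  unfolding stress_apply_def sum_distrib_left sum_distrib_right
  by (subst sum.swap) (simp only: mult.assoc)

lemma stress_apply_sum_point:
  "stress_apply V \<omega> (\<lambda>x. \<Sum>i\<in>A. a i * H i x) y = (\<Sum>i\<in>A. a i * stress_apply V \<omega> (H i) y)"
proof -
  have "stress_apply V \<omega> (\<lambda>x. \<Sum>i\<in>A. a i * H i x) y =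
      (\<Sum>x\<in>V. \<Sum>i\<in>A. a i * (\<omega> {x, y} * (H i x - H i y)))"
    unfolding stress_apply_def sum_subtractf[symmetric] sum_distrib_left
    by (intro sum.cong refl) (simp add: algebra_simps)
  then show ?thesis
    unfolding stress_apply_def sum_distrib_left by (subst sum.swap) simp
qed

lemma stress_apply_add_point:
  "stress_apply V \<omega> (\<lambda>x. h x + g x) y = stress_apply V \<omega> h y + stress_apply V \<omega> g y"
  unfolding stress_apply_def sum.distrib[symmetric] by (intro sum.cong refl) (simp add: algebra_simps)

lemma stress_apply_const [simp]: "stress_apply V \<omega> (\<lambda>x. c) y = 0"
  by (simp add: stress_apply_def)

text \<open>The weight of an edge does not depend on the order of its ends, so swapping the sums
  exchanges \<open>g\<close> and \<open>h\<close> in the cross terms; the remaining terms are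
  symmetric already.\<close>

lemma stress_apply_symmetric:
  "(\<Sum>y\<in>V. g y * stress_apply V \<omega> h y) = (\<Sum>y\<in>V. h y * stress_apply V \<omega> g y)"
proof -
  have "(\<Sum>y\<in>V. g y * stress_apply V \<omega> h y) =
      (\<Sum>y\<in>V. \<Sum>x\<in>V. \<omega> {x, y} * (g y * h x)) - (\<Sum>y\<in>V. \<Sum>x\<in>V. \<omega> {x, y} * (g y * h y))" for g h
    unfolding stress_apply_def sum_subtractf[symmetric] sum_distrib_left
    by (intro sum.cong refl) (simp add: algebra_simps)
  moreover have "(\<Sum>y\<in>V. \<Sum>x\<in>V. \<omega> {x, y} * (g y * h x)) = (\<Sum>y\<in>V. \<Sum>x\<in>V. \<omega> {x, y} * (h y * g x))"
    by (subst sum.swap) (simp add: insert_commute mult.commute)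
  ultimately show ?thesis by (simp add: mult.commute)
qed

lemma is_stress_diff_scale:
  assumes "is_stress k V F p \<omega>" "is_stress k V F p \<eta>"
  shows "is_stress k V F p (\<lambda>e. \<omega> e - s * \<eta> e)"
  using assms unfolding is_stress_def by (simp add: stress_apply_diff_scale)

lemma is_stress_sum:
  assumes "\<And>i. i \<in> A \<Longrightarrow> is_stress k V F p (W i)"
  shows "is_stress k V F p (\<lambda>e. \<Sum>i\<in>A. a i * W i e)"
  using assms unfolding is_stress_def by (simp add: stress_apply_sum_stress)

lemma is_stress_scale: "is_stress k V F p \<omega> \<Longrightarrow> is_stress k V F p (\<lambda>e. s * \<omega> e)"
  using is_stress_sum[of "{0 :: nat}" k V F p "\<lambda>_. \<omega>" "\<lambda>_. s"] by simp

section \<open>Stresses as row dependences of the rigidity matrix\<close>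

lemma rigidity_matrix_edge:
  assumes "x \<noteq> y"
  shows "rigidity_matrix p {x, y} y i = p y i - p x i"
proof -
  have "{x, y} - {y} = {x}" using assms by auto
  then show ?thesis by (simp add: rigidity_matrix_def)
qed

lemma rigidity_matrix_row_sum:
  assumes "finite V" "a \<in> V" "b \<in> V" "a \<noteq> b"
  shows "(\<Sum>v\<in>V. rigidity_matrix p {a, b} v i * g v) = (p a i - p b i) * (g a - g b)"
proof -
  have "(\<Sum>v\<in>V. rigidity_matrix p {a, b} v i * g v) = (\<Sum>v\<in>{a, b}. rigidity_matrix p {a, b} v i * g v)"
    by (rule sum.mono_neutral_right) (use assms in \<open>auto simp: rigidity_matrix_def\<close>)
  also have "\<dots> = (p a i - p b i) * g a + (p b i - p a i) * g b"
    using rigidity_matrix_edge[of a b p i] rigidity_matrix_edge[of b a p i] assms(4)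
    by (simp add: insert_commute)
  finally show ?thesis by (simp add: algebra_simps)
qed

lemma rigidity_matrix_column_sum:
  assumes "finite V" "F \<subseteq> nsets V 2" "\<And>e. e \<notin> F \<Longrightarrow> \<omega> e = 0" "y \<in> V"
  shows "(\<Sum>e\<in>F. \<omega> e * rigidity_matrix p e y i) = - stress_apply V \<omega> (\<lambda>x. p x i) y"
proof -
  let ?X = "{x \<in> V. {x, y} \<in> F}"
  have finF: "finite F"
    using assms(1,2) by (meson finite_imp_finite_nsets finite_subset)
  \<comment> \<open>Only edges through \<open>y\<close> contribute, and they are indexed by their
    other end.\<close>
  have "(\<Sum>e\<in>F. \<omega> e * rigidity_matrix p e y i) =
      (\<Sum>e\<in>(\<lambda>x. {x, y}) ` ?X. \<omega> e * rigidity_matrix p e y i)"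
  proof (rule sum.mono_neutral_right[OF finF])
    show "\<forall>e\<in>F - (\<lambda>x. {x, y}) ` ?X. \<omega> e * rigidity_matrix p e y i = 0"
    proof
      fix e assume e: "e \<in> F - (\<lambda>x. {x, y}) ` ?X"
      then have "e \<in> nsets V 2" using assms(2) by blast
      then obtain a b where "e = {a, b}" "a \<in> V" "b \<in> V" "a \<noteq> b"
        by (rule nsets_2_E)
      then have "y \<notin> e" using e by (auto simp: insert_commute)
      then show "\<omega> e * rigidity_matrix p e y i = 0" by (simp add: rigidity_matrix_def)
    qed
  qed auto
  also have "\<dots> = (\<Sum>x\<in>?X. \<omega> {x, y} * rigidity_matrix p {x, y} y i)"
    by (subst sum.reindex) (auto simp: inj_on_def doubleton_eq_iff)
  also have "\<dots> = (\<Sum>x\<in>?X. - (\<omega> {x, y} * (p x i - p y i)))"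
  proof (rule sum.cong[OF refl])
    fix x assume "x \<in> ?X"
    then have "{x, y} \<in> nsets V 2" using assms(2) by blast
    then have "x \<noteq> y" by (simp only: nsets_2_mem) simp
    then show "\<omega> {x, y} * rigidity_matrix p {x, y} y i = - (\<omega> {x, y} * (p x i - p y i))"
      by (simp add: rigidity_matrix_edge algebra_simps)
  qed
  also have "\<dots> = - (\<Sum>x\<in>V. \<omega> {x, y} * (p x i - p y i))"
    unfolding sum_negf using assms(1,3)
    by (intro arg_cong[of _ _ uminus] sum.mono_neutral_left) auto
  finally show ?thesis unfolding stress_apply_def .
qed

lemma is_stress_iff_rows:
  assumes "finite V" "F \<subseteq> nsets V 2" "\<And>e. e \<notin> F \<Longrightarrow> \<omega> e = 0"
  shows "is_stress k V F p \<omega> \<longleftrightarrow> (\<forall>v\<in>V. \<forall>i<k. (\<Sum>e\<in>F. \<omega> e * rigidity_matrix p e v i) = 0)"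
  using rigidity_matrix_column_sum[OF assms] assms(3) unfolding is_stress_def by simp

lemma is_stress_of_rows:
  assumes "finite V" "F \<subseteq> nsets V 2"
    and "\<forall>v\<in>V. \<forall>i<k. (\<Sum>e\<in>F. c e * rigidity_matrix p e v i) = 0"
  shows "is_stress k V F p (\<lambda>e. if e \<in> F then c e else 0)"
proof -
  have "(\<Sum>e\<in>F. (if e \<in> F then c e else 0) * rigidity_matrix p e v i) =
      (\<Sum>e\<in>F. c e * rigidity_matrix p e v i)" for v i
    by (rule sum.cong) auto
  then show ?thesis
    using assms by (subst is_stress_iff_rows) auto
qed

lemma rows_independent_iff:
  assumes "finite V" "F \<subseteq> nsets V 2"
  shows "rows_independent k V p F \<longleftrightarrow> (\<forall>\<omega>. is_stress k V F p \<omega> \<longrightarrow> (\<forall>e. \<omega> e = 0))"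
proof
  assume L: "rows_independent k V p F"
  show "\<forall>\<omega>. is_stress k V F p \<omega> \<longrightarrow> (\<forall>e. \<omega> e = 0)"
  proof (intro allI impI)
    fix \<omega> e assume \<omega>: "is_stress k V F p \<omega>"
    then have off: "e \<notin> F \<Longrightarrow> \<omega> e = 0" for e unfolding is_stress_def by blast
    then have "\<forall>v\<in>V. \<forall>i<k. (\<Sum>e\<in>F. \<omega> e * rigidity_matrix p e v i) = 0"
      using is_stress_iff_rows[OF assms, of \<omega> k p] \<omega> by simp
    then show "\<omega> e = 0"
      using L off unfolding rows_independent_def by blast
  qed
next
  assume R: "\<forall>\<omega>. is_stress k V F p \<omega> \<longrightarrow> (\<forall>e. \<omega> e = 0)"
  show "rows_independent k V p F"
    unfolding rows_independent_def
  proof (intro allI impI ballI)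
    fix c e assume "\<forall>v\<in>V. \<forall>i<k. (\<Sum>e\<in>F. c e * rigidity_matrix p e v i) = 0" "e \<in> F"
    then have "(if e \<in> F then c e else 0) = 0"
      using spec[OF R, of "\<lambda>e. if e \<in> F then c e else 0"] is_stress_of_rows[OF assms, of k c p]
      by blast
    then show "c e = 0" using \<open>e \<in> F\<close> by simp
  qed
qed

section \<open>Generic frameworks\<close>

lemma generic_subset: "generic k V p \<Longrightarrow> W \<subseteq> V \<Longrightarrow> l \<le> k \<Longrightarrow> generic l W p"
  unfolding generic_def by (erule alg_independent_subset) auto

lemma generic_extend:
  assumes "finite V" "generic d V p"
  shows "\<exists>h. generic (Suc d) V (\<lambda>v i. if i = d then h v else p v i)"
proof -
  obtain y where y: "alg_independent (V \<times> {..<d} \<union> V \<times> {..<Suc d}) y"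
    "\<forall>i\<in>V \<times> {..<d}. y i = (\<lambda>(v, i). p v i) i"
    using alg_independent_extend[of "V \<times> {..<Suc d}" "V \<times> {..<d}" "\<lambda>(v, i). p v i"] assms
    unfolding generic_def by blast
  have "V \<times> {..<d} \<union> V \<times> {..<Suc d} = V \<times> {..<Suc d}" by auto
  then have "alg_independent (V \<times> {..<Suc d}) y" using y(1) by simp
  moreover have "y i = (\<lambda>(v, i). if i = d then y (v, d) else p v i) i"
    if "i \<in> V \<times> {..<Suc d}" for i
    using that y(2) by (auto simp: less_Suc_eq)
  ultimately have "alg_independent (V \<times> {..<Suc d}) (\<lambda>(v, i). if i = d then y (v, d) else p v i)"
    using alg_independent_cong[of "V \<times> {..<Suc d}" y] by blast
  then show ?thesis
    unfolding generic_def by (intro exI[of _ "\<lambda>v. y (v, d)"])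
qed

lemma generic_framework_generic:
  assumes "finite V"
  shows "generic k V (generic_framework k V)"
proof -
  have "\<exists>p. generic k V p"
  proof (induction k)
    case 0
    then show ?case by (simp add: generic_def alg_independent_empty)
  next
    case (Suc k)
    then show ?case using generic_extend[OF assms] by blast
  qed
  then show ?thesis
    unfolding generic_framework_def by (rule someI_ex)
qed

text \<open>Yields two generic extensions of \<open>p\<close> that differ by the unit vector at
  \<open>w\<close>: a linear functional that vanishes on both vanishes on this unit vector.\<close>

lemma generic_shift:
  assumes "generic (Suc d) V (\<lambda>v i. if i = d then h v else p v i)"
  shows "generic (Suc d) V (\<lambda>v i. if i = d then (h(w := h w + 1)) v else p v i)"
proof -
  let ?x = "\<lambda>(v, i). if i = d then h v else p v i"
  have "alg_independent (V \<times> {..<Suc d}) (?x((w, d) := ?x (w, d) + 1))"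
    by (rule alg_independent_shift) (use assms in \<open>simp add: generic_def\<close>)
  moreover have "?x((w, d) := ?x (w, d) + 1) = (\<lambda>(v, i). if i = d then (h(w := h w + 1)) v else p v i)"
    by (rule ext) (simp split: prod.split)
  ultimately show ?thesis unfolding generic_def by simp
qed

lemma qpolyfun_rigidity_matrix:
  assumes "e \<in> nsets V 2" "i < k"
  shows "qpolyfun (V \<times> {..<k}) (\<lambda>x. rigidity_matrix (\<lambda>v i. x (v, i)) e y i)"
proof (cases "y \<in> e")
  case True
  have "e \<subseteq> V" using assms(1) by (simp add: nsets_def)
  then have "qpolyfun (V \<times> {..<k}) (\<lambda>x. x (y, i) - x (w, i))" if "w \<in> e" for w
    using that True assms(2) by (intro qpolyfun_diff qpolyfun_var) auto
  then have "qpolyfun (V \<times> {..<k}) (\<lambda>x. \<Sum>w\<in>e - {y}. x (y, i) - x (w, i))"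
    by (intro qpolyfun_sum) simp
  then show ?thesis
    using True by (simp add: rigidity_matrix_def)
next
  case False
  then show ?thesis by (simp add: rigidity_matrix_def)
qed

text \<open>Instance of \<open>kernel_transfer\<close> in which the unknowns are the edge weights.
  It makes independence of rows the same at all generic frameworks.\<close>

lemma stress_transfer:
  assumes V: "finite V" and F: "F \<subseteq> nsets V 2"
    and p: "generic k V p" and q: "generic k V q"
    and \<omega>: "is_stress k V F p \<omega>" "\<omega> e \<noteq> 0"
  shows "\<exists>\<omega>. is_stress k V F q \<omega> \<and> \<omega> e \<noteq> 0"
proof -
  let ?M = "\<lambda>r e x. rigidity_matrix (\<lambda>v i. x (v, i)) e (fst r) (snd r)"
  have fin: "finite (V \<times> {..<k})" "finite F"
    using V F by (auto intro: finite_subset finite_imp_finite_nsets)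
  have off: "\<And>e. e \<notin> F \<Longrightarrow> \<omega> e = 0" using \<omega>(1) unfolding is_stress_def by blast
  have e: "e \<in> F" using \<omega>(2) off by blast
  have "\<forall>r\<in>V \<times> {..<k}. (\<Sum>e\<in>F. \<omega> e * ?M r e (\<lambda>(v, i). p v i)) = 0"
    using \<omega>(1) is_stress_iff_rows[OF V F off] by auto
  then have "\<exists>z. (\<forall>r\<in>V \<times> {..<k}. (\<Sum>e\<in>F. z e * ?M r e (\<lambda>(v, i). q v i)) = 0) \<and> z e \<noteq> 0"
    using e \<omega>(2) p q F unfolding generic_def
    by (intro kernel_transfer[OF fin, of "V \<times> {..<k}" ?M "\<lambda>(v, i). p v i"])
      (auto intro!: qpolyfun_rigidity_matrix)
  then obtain z where z: "\<forall>r\<in>V \<times> {..<k}. (\<Sum>e\<in>F. z e * ?M r e (\<lambda>(v, i). q v i)) = 0" "z e \<noteq> 0"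
    by blast
  then have "is_stress k V F q (\<lambda>e. if e \<in> F then z e else 0)"
    by (intro is_stress_of_rows[OF V F]) auto
  then show ?thesis
    using z(2) e by (intro exI[of _ "\<lambda>e. if e \<in> F then z e else 0"]) simp
qed

section \<open>Linked pairs and stress independence\<close>

definition stress_free :: "nat \<Rightarrow> 'a set \<Rightarrow> 'a set set \<Rightarrow> 'a framework \<Rightarrow> bool" where
  "stress_free k V F p \<longleftrightarrow> (\<forall>\<omega>. is_stress k V F p \<omega> \<longrightarrow> (\<forall>e. \<omega> e = 0))"

lemma simple_graphD:
  assumes "simple_graph G"
  shows "finite (verts G)" "edges G \<subseteq> nsets (verts G) 2" "finite (edges G)"
  using assms unfolding simple_graph_def
  by (auto intro: finite_subset finite_imp_finite_nsets)

lemma stress_free_generic: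
  assumes "finite V" "F \<subseteq> nsets V 2" "generic k V p" "generic k V q" "stress_free k V F p"
  shows "stress_free k V F q"
  using assms(5) stress_transfer[OF assms(1,2,4,3)] unfolding stress_free_def by blast

lemma rigidity_indep_set_iff:
  assumes G: "simple_graph G" and p: "generic k (verts G) p"
  shows "rigidity_indep_set k G F \<longleftrightarrow> F \<subseteq> edges G \<and> stress_free k (verts G) F p"
proof (cases "F \<subseteq> edges G")
  case True
  then have F: "F \<subseteq> nsets (verts G) 2" using simple_graphD[OF G] by blast
  let ?g = "generic_framework k (verts G)"
  have "generic k (verts G) ?g"
    by (rule generic_framework_generic) (rule simple_graphD[OF G])
  then have "stress_free k (verts G) F ?g \<longleftrightarrow> stress_free k (verts G) F p"
    using stress_free_generic[OF simple_graphD(1)[OF G] F] p by blast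
  then show ?thesis
    unfolding rigidity_indep_set_def rows_independent_iff[OF simple_graphD(1)[OF G] F]
      stress_free_def[symmetric] by simp
qed (simp add: rigidity_indep_set_def)

lemma stress_free_empty: "stress_free k V {} p"
  unfolding stress_free_def is_stress_def by simp

lemma rank_set:
  assumes G: "simple_graph G" and p: "generic k (verts G) p"
  shows "finite {card F |F. rigidity_indep_set k G F}" "{card F |F. rigidity_indep_set k G F} \<noteq> {}"
proof -
  have "{card F |F. rigidity_indep_set k G F} \<subseteq> card ` Pow (edges G)"
    unfolding rigidity_indep_set_def by auto
  then show "finite {card F |F. rigidity_indep_set k G F}"
    using simple_graphD[OF G] finite_subset by blast
  have "rigidity_indep_set k G {}"
    unfolding rigidity_indep_set_iff[OF assms] by (simp add: stress_free_empty)
  then show "{card F |F. rigidity_indep_set k G F} \<noteq> {}" by blast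
qed

lemma card_le_rigidity_rank:
  assumes "simple_graph G" "generic k (verts G) p" "F \<subseteq> edges G" "stress_free k (verts G) F p"
  shows "card F \<le> rigidity_rank k G"
proof -
  have "rigidity_indep_set k G F"
    unfolding rigidity_indep_set_iff[OF assms(1,2)] using assms by simp
  then have "card F \<in> {card F |F. rigidity_indep_set k G F}" by blast
  then show ?thesis
    unfolding rigidity_rank_def using rank_set[OF assms(1,2)] by simp
qed

text \<open>A stress that vanished at \<open>f\<close> would live on the stress-free set
  \<open>F\<close>, so a nonzero one can be normalised at \<open>f\<close>.\<close>

lemma circuit_stress:
  assumes "stress_free k V F p" "\<not> stress_free k V (insert f F) p"
  shows "\<exists>\<omega>. is_stress k V (insert f F) p \<omega> \<and> \<omega> f = 1"
proof -
  obtain \<omega> e where \<omega>: "is_stress k V (insert f F) p \<omega>" "\<omega> e \<noteq> 0"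
    using assms(2) unfolding stress_free_def by blast
  have "\<omega> f \<noteq> 0"
  proof
    assume "\<omega> f = 0"
    then have "is_stress k V F p \<omega>"
      by (intro is_stress_restrict[OF \<omega>(1)]) auto
    then show False using assms(1) \<omega>(2) unfolding stress_free_def by blast
  qed
  then show ?thesis
    using is_stress_scale[OF \<omega>(1), of "1 / \<omega> f"]
    by (intro exI[of _ "\<lambda>e. 1 / \<omega> f * \<omega> e"]) simp
qed

lemma rigidity_base:
  assumes G: "simple_graph G" and p: "generic k (verts G) p"
  obtains F where "F \<subseteq> edges G" "stress_free k (verts G) F p" "card F = rigidity_rank k G"
    "\<forall>f\<in>edges G - F. \<exists>\<omega>. is_stress k (verts G) (insert f F) p \<omega> \<and> \<omega> f = 1"
proof -
  have "rigidity_rank k G \<in> {card F |F. rigidity_indep_set k G F}"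
    unfolding rigidity_rank_def by (rule Max_in) (rule rank_set[OF assms])+
  then obtain F where "card F = rigidity_rank k G" "rigidity_indep_set k G F" by auto
  then have F: "card F = rigidity_rank k G" "F \<subseteq> edges G" "stress_free k (verts G) F p"
    unfolding rigidity_indep_set_iff[OF assms] by auto
  have finF: "finite F"
    using F(2) simple_graphD(3)[OF G] finite_subset by blast
  have "\<not> stress_free k (verts G) (insert f F) p" if f: "f \<in> edges G - F" for f
  proof
    assume "stress_free k (verts G) (insert f F) p"
    then have "card (insert f F) \<le> rigidity_rank k G"
      by (intro card_le_rigidity_rank[OF assms]) (use f F in auto)
    then show False using f F finF by simp
  qed
  then show ?thesis
    using that[OF F(2,3,1)] circuit_stress[OF F(3)] by blast
qed

lemma simple_graph_del_edge: "simple_graph G \<Longrightarrow> simple_graph (del_edge G u v)"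
  unfolding simple_graph_def del_edge_def by auto

lemma del_edge_simps [simp]:
  "verts (del_edge G u v) = verts G" "edges (del_edge G u v) = edges G - {{u, v}}"
  by (simp_all add: del_edge_def)

lemma add_edge_del_edge: "{u, v} \<in> edges G \<Longrightarrow> add_edge (del_edge G u v) u v = G"
  by (simp add: add_edge_def del_edge_def insert_absorb)

text \<open>In matroid terms, deleting an element keeps the rank unless no dependence involves it.
  As \<open>p\<close> is an arbitrary generic framework, linkedness can be tested at any of
  them.\<close>

lemma linked_iff:
  assumes G: "simple_graph G" and uv: "{u, v} \<in> edges G" and p: "generic d (verts G) p"
  shows "linked d (del_edge G u v) u v \<longleftrightarrow>
    (\<exists>\<omega>. is_stress d (verts G) (edges G) p \<omega> \<and> \<omega> {u, v} \<noteq> 0)"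
proof -
  let ?H = "del_edge G u v"
  note H = simple_graph_del_edge[OF G, of u v]
  have pH: "generic d (verts ?H) p" using p by simp
  have uv': "u \<in> verts G" "v \<in> verts G" "u \<noteq> v"
    using subsetD[OF simple_graphD(2)[OF G] uv] unfolding nsets_2_mem by auto
  have le: "rigidity_rank d ?H \<le> rigidity_rank d G"
  proof -
    obtain F where "F \<subseteq> edges ?H" "stress_free d (verts ?H) F p" "card F = rigidity_rank d ?H"
      by (rule rigidity_base[OF H pH])
    then show ?thesis using card_le_rigidity_rank[OF G p, of F] by auto
  qed
  have "rigidity_rank d G = rigidity_rank d ?H \<longleftrightarrow>
    (\<exists>\<omega>. is_stress d (verts G) (edges G) p \<omega> \<and> \<omega> {u, v} \<noteq> 0)"
  proof
    assume eq: "rigidity_rank d G = rigidity_rank d ?H"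
    obtain F where F: "F \<subseteq> edges ?H" "stress_free d (verts ?H) F p" "card F = rigidity_rank d ?H"
      by (rule rigidity_base[OF H pH])
    have finF: "finite F"
      using F(1) simple_graphD(3)[OF H] finite_subset by blast
    have "{u, v} \<notin> F" using F(1) by auto
    then have "card (insert {u, v} F) > rigidity_rank d G"
      using F(3) eq finF by simp
    then have "\<not> stress_free d (verts G) (insert {u, v} F) p"
      using card_le_rigidity_rank[OF G p, of "insert {u, v} F"] F(1) uv by auto
    then obtain \<omega> where "is_stress d (verts G) (insert {u, v} F) p \<omega>" "\<omega> {u, v} = 1"
      using circuit_stress[of d "verts G" F p "{u, v}"] F(2) by auto
    then show "\<exists>\<omega>. is_stress d (verts G) (edges G) p \<omega> \<and> \<omega> {u, v} \<noteq> 0"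
      using F(1) uv by (intro exI[of _ \<omega>] conjI is_stress_mono[of d "verts G" _ p \<omega> "edges G"]) auto
  next
    assume "\<exists>\<omega>. is_stress d (verts G) (edges G) p \<omega> \<and> \<omega> {u, v} \<noteq> 0"
    then obtain \<omega> where \<omega>: "is_stress d (verts G) (edges G) p \<omega>" "\<omega> {u, v} \<noteq> 0" by blast
    show "rigidity_rank d G = rigidity_rank d ?H"
    proof (rule ccontr)
      assume "rigidity_rank d G \<noteq> rigidity_rank d ?H"
      with le have less: "rigidity_rank d ?H < rigidity_rank d G" by simp
      obtain F where F: "F \<subseteq> edges G" "stress_free d (verts G) F p" "card F = rigidity_rank d G"
        by (rule rigidity_base[OF G p])
      have finF: "finite F"
        using F(1) simple_graphD(3)[OF G] finite_subset by blast
      have free': "stress_free d (verts G) F' p" if "F' \<subseteq> F" for F'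
        using F(2) is_stress_mono[OF _ that] unfolding stress_free_def by blast
      have uvF: "{u, v} \<in> F"
      proof (rule ccontr)
        assume "{u, v} \<notin> F"
        then have "card F \<le> rigidity_rank d ?H"
          using card_le_rigidity_rank[OF H pH, of F] F by auto
        then show False using less F(3) by simp
      qed
      let ?F' = "F - {{u, v}}"
      have card': "Suc (card ?F') = card F"
        using finF uvF by (rule card_Suc_Diff1)
      let ?D = "edges G - F"
      \<comment> \<open>Otherwise replacing \<open>uv\<close> by \<open>f\<close> in the base would
        give an independent set that avoids \<open>uv\<close> and is as large as \<open>F\<close>,
        contrary to the drop in rank.\<close>
      have "\<exists>\<eta>. is_stress d (verts G) (insert f ?F') p \<eta> \<and> \<eta> f = 1" if f: "f \<in> ?D" for f
      proof (rule circuit_stress[OF free'], blast)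
        show "\<not> stress_free d (verts G) (insert f ?F') p"
        proof
          assume "stress_free d (verts G) (insert f ?F') p"
          moreover have "insert f ?F' \<subseteq> edges ?H" using F(1) f uvF by auto
          ultimately have "card (insert f ?F') \<le> rigidity_rank d ?H"
            using card_le_rigidity_rank[OF H pH, of "insert f ?F'"] by simp
          moreover have "card (insert f ?F') = card F" using f finF card' by simp
          ultimately show False using less F(3) by simp
        qed
      qed
      then have "\<forall>f\<in>?D. \<exists>\<eta>. is_stress d (verts G) (insert f ?F') p \<eta> \<and> \<eta> f = 1"
        by blast
      from bchoice[OF this] obtain W where
        W: "\<And>f. f \<in> ?D \<Longrightarrow> is_stress d (verts G) (insert f ?F') p (W f)"
          "\<And>f. f \<in> ?D \<Longrightarrow> W f f = 1"
        by blast
      have off: "W f e = 0" if "f \<in> ?D" "e \<notin> insert f ?F'" for f e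
      proof -
        have "\<forall>e. e \<notin> insert f ?F' \<longrightarrow> W f e = 0"
          using W(1)[OF that(1)] unfolding is_stress_def by (rule conjunct1)
        then show ?thesis using that(2) by simp
      qed
      \<comment> \<open>This clears all edges outside \<open>F\<close> and keeps the value at
        \<open>uv\<close>, because no \<open>W f\<close> involves \<open>uv\<close>; a nonzero
        stress on the base \<open>F\<close> remains. The factor 1 matches the form of
        \<open>is_stress_diff_scale\<close>.\<close>
      define \<eta> where "\<eta> e = \<omega> e - 1 * (\<Sum>f\<in>?D. \<omega> f * W f e)" for e
      have "is_stress d (verts G) (edges G) p (W f)" if "f \<in> ?D" for f
        by (rule is_stress_mono[OF W(1)[OF that]]) (use F(1) that in auto)
      then have \<eta>: "is_stress d (verts G) (edges G) p \<eta>"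
        unfolding \<eta>_def by (intro is_stress_diff_scale \<omega>(1) is_stress_sum)
      have "\<eta> e = 0" if "e \<in> ?D" for e
      proof -
        have "(\<Sum>f\<in>?D. \<omega> f * W f e) = (\<Sum>f\<in>?D. \<omega> f * (if f = e then 1 else 0))"
          by (rule sum.cong) (use off W(2) that in auto)
        then show ?thesis
          using that simple_graphD(3)[OF G] by (simp add: \<eta>_def sum_mult_unit_vector)
      qed
      then have "is_stress d (verts G) F p \<eta>"
        using is_stress_restrict[OF \<eta>] by blast
      moreover have "(\<Sum>f\<in>?D. \<omega> f * W f {u, v}) = 0"
      proof (rule sum.neutral, rule ballI)
        fix f assume f: "f \<in> ?D"
        then have "{u, v} \<notin> insert f ?F'" using uvF by auto
        then show "\<omega> f * W f {u, v} = 0" using off[OF f] by simp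
      qed
      then have "\<eta> {u, v} \<noteq> 0" using \<omega>(2) by (simp add: \<eta>_def)
      ultimately show False using F(2) unfolding stress_free_def by blast
    qed
  qed
  then show ?thesis
    unfolding linked_def using uv' add_edge_del_edge[OF uv] by simp
qed

lemma stress_linked_iff:
  assumes G: "simple_graph G" and uv: "{u, v} \<in> edges G"
  shows "stress_linked d (del_edge G u v) u v \<longleftrightarrow> linked d (del_edge G u v) u v \<and>
    (\<forall>p q. generic d (verts G) p \<and>
        (\<forall>\<omega>. is_stress d (verts G) (edges G - {{u, v}}) p \<omega> \<longrightarrow>
          is_stress d (verts G) (edges G - {{u, v}}) q \<omega>) \<longrightarrow>
      (\<forall>\<omega>. is_stress d (verts G) (edges G) p \<omega> \<longrightarrow> is_stress d (verts G) (edges G) q \<omega>))"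
  unfolding stress_linked_def add_edge_del_edge[OF uv] stresses_eq[OF G]
    stresses_eq[OF simple_graph_del_edge[OF G]] del_edge_simps by (simp add: subset_iff)

text \<open>
  Let \<open>\<eta>\<close> be a stress of \<open>(p, h)\<close> in dimension \<open>d + 1\<close> with \<open>\<eta> {u, v} \<noteq> 0\<close>, where \<open>h\<close> is any
  generic extension of \<open>p\<close>. A stress \<open>\<omega>\<close> of \<open>(G, p)\<close> differs from a multiple of \<open>\<eta>\<close> by
  a stress of \<open>(G - uv, p)\<close>, so on a coordinate \<open>g\<close> of \<open>q\<close> they act alike up to the factor \<open>s\<close>.
  Stress matrices are symmetric and \<open>\<eta>\<close> annihilates \<open>h\<close>, so \<open>\<omega> g\<close> is orthogonal to every
  such \<open>h\<close>; these span everything.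
\<close>

lemma stress_linked_of_higher_stress:
  assumes G: "simple_graph G" and uv: "{u, v} \<in> edges G"
    and P: "generic (Suc d) (verts G) P"
    and \<omega>0: "is_stress (Suc d) (verts G) (edges G) P \<omega>0" "\<omega>0 {u, v} \<noteq> 0"
  shows "stress_linked d (del_edge G u v) u v"
  unfolding stress_linked_iff[OF G uv]
proof (intro conjI allI impI; (elim conjE)?)
  let ?V = "verts G"
  let ?E = "edges G"
  note V = simple_graphD(1)[OF G] and E = simple_graphD(2)[OF G]
  have "generic d ?V P" using generic_subset[OF P] by simp
  moreover have "is_stress d ?V ?E P \<omega>0" using is_stress_dim_mono[OF \<omega>0(1)] by simp
  ultimately show "linked d (del_edge G u v) u v"
    using linked_iff[OF G uv] \<omega>0(2) by blast
  fix p q \<omega>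
  assume p: "generic d ?V p"
    and pq: "\<forall>\<omega>. is_stress d ?V (?E - {{u, v}}) p \<omega> \<longrightarrow> is_stress d ?V (?E - {{u, v}}) q \<omega>"
    and \<omega>: "is_stress d ?V ?E p \<omega>"
  have orth: "(\<Sum>y\<in>?V. h y * stress_apply ?V \<omega> (\<lambda>x. q x i) y) = 0"
    if h: "generic (Suc d) ?V (\<lambda>v i. if i = d then h v else p v i)" and i: "i < d" for h i
  proof -
    let ?P = "\<lambda>v i. if i = d then h v else p v i"
    obtain \<eta> where \<eta>: "is_stress (Suc d) ?V ?E ?P \<eta>" "\<eta> {u, v} \<noteq> 0"
      using stress_transfer[OF V E P h \<omega>0] by blast
    have "is_stress d ?V ?E ?P \<eta>" using is_stress_dim_mono[OF \<eta>(1)] by simp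
    then have \<eta>p: "is_stress d ?V ?E p \<eta>"
      using is_stress_cong[of ?V d ?P p] by simp
    have \<eta>h: "stress_apply ?V \<eta> h y = 0" if "y \<in> ?V" for y
      using \<eta>(1) that unfolding is_stress_def by fastforce
    define s where "s = \<omega> {u, v} / \<eta> {u, v}"
    have "is_stress d ?V (?E - {{u, v}}) p (\<lambda>e. \<omega> e - s * \<eta> e)"
      by (rule is_stress_restrict[OF is_stress_diff_scale[OF \<omega> \<eta>p]])
        (use \<eta>(2) in \<open>auto simp: s_def\<close>)
    then have "is_stress d ?V (?E - {{u, v}}) q (\<lambda>e. \<omega> e - s * \<eta> e)" using pq by blast
    then have "stress_apply ?V \<omega> (\<lambda>x. q x i) y = s * stress_apply ?V \<eta> (\<lambda>x. q x i) y"
      if "y \<in> ?V" for y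
      using that i unfolding is_stress_def stress_apply_diff_scale by auto
    then have "(\<Sum>y\<in>?V. h y * stress_apply ?V \<omega> (\<lambda>x. q x i) y) =
        s * (\<Sum>y\<in>?V. h y * stress_apply ?V \<eta> (\<lambda>x. q x i) y)"
      unfolding sum_distrib_left by (intro sum.cong) simp_all
    also have "\<dots> = s * (\<Sum>y\<in>?V. q y i * stress_apply ?V \<eta> h y)"
      using stress_apply_symmetric[of h ?V \<eta>] by simp
    also have "\<dots> = 0" using \<eta>h by simp
    finally show ?thesis .
  qed
  obtain h where h: "generic (Suc d) ?V (\<lambda>v i. if i = d then h v else p v i)"
    using generic_extend[OF V p] by blast
  have "stress_apply ?V \<omega> (\<lambda>x. q x i) w = 0" if i: "i < d" and w: "w \<in> ?V" for i w
  proof -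
    let ?g = "stress_apply ?V \<omega> (\<lambda>x. q x i)"
    have "(\<Sum>y\<in>?V. (h(w := h w + 1)) y * ?g y) =
        (\<Sum>y\<in>?V. h y * ?g y + (if y = w then 1 else 0) * ?g y)"
      by (rule sum.cong) (auto simp: distrib_right)
    then have "(\<Sum>y\<in>?V. (h(w := h w + 1)) y * ?g y) = (\<Sum>y\<in>?V. h y * ?g y) + ?g w"
      by (simp only: sum.distrib sum_mult_unit_vector[OF V w])
    then show ?thesis
      using orth[OF h i] orth[OF generic_shift[OF h, of w] i] by simp
  qed
  moreover have "\<omega> e = 0" if "e \<notin> ?E" for e
    using \<omega> that unfolding is_stress_def by blast
  ultimately show "is_stress d ?V ?E q \<omega>"
    unfolding is_stress_def by blast
qed

lemma rigidity_independent_of_stress_independent: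
  assumes G: "simple_graph G" and indep: "stress_independent d G"
  shows "rigidity_independent (Suc d) G"
proof -
  let ?P = "generic_framework (Suc d) (verts G)"
  have P: "generic (Suc d) (verts G) ?P"
    by (rule generic_framework_generic) (rule simple_graphD[OF G])
  have "\<omega> e = 0" if \<omega>: "is_stress (Suc d) (verts G) (edges G) ?P \<omega>" for \<omega> e
  proof (rule ccontr)
    assume e: "\<omega> e \<noteq> 0"
    then have "e \<in> edges G" using \<omega> unfolding is_stress_def by blast
    moreover from this obtain u v where "e = {u, v}"
      using simple_graphD(2)[OF G] by (blast elim: nsets_2_E)
    ultimately show False
      using stress_linked_of_higher_stress[OF G _ P \<omega>] e indep
      unfolding stress_independent_def by blast
  qed
  then have "stress_free (Suc d) (verts G) (edges G) ?P"
    unfolding stress_free_def by blast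
  then show ?thesis
    unfolding rigidity_independent_def rigidity_indep_set_iff[OF G P] by simp
qed

section \<open>Passing to subgraphs\<close>

lemma stress_apply_extend:
  assumes "finite V" "W \<subseteq> V" "F \<subseteq> nsets W 2" "\<And>e. e \<notin> F \<Longrightarrow> \<omega> e = 0"
  shows "stress_apply V \<omega> h y = (if y \<in> W then stress_apply W \<omega> h y else 0)"
proof -
  have off: "\<omega> {x, y} = 0" if "x \<notin> W \<or> y \<notin> W" for x y
  proof -
    have "{x, y} \<notin> nsets W 2" unfolding nsets_2_mem using that by blast
    then show ?thesis using assms(3,4) by blast
  qed
  show ?thesis
  proof (cases "y \<in> W")
    case True
    have "stress_apply V \<omega> h y = stress_apply W \<omega> h y"
      unfolding stress_apply_def
      by (rule sum.mono_neutral_right[OF assms(1,2)]) (simp add: off)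
    then show ?thesis using True by simp
  next
    case False
    then show ?thesis by (simp add: stress_apply_def off)
  qed
qed

lemma is_stress_extend:
  assumes "finite V" "W \<subseteq> V" "F \<subseteq> nsets W 2"
  shows "is_stress k V F p \<omega> \<longleftrightarrow> is_stress k W F p \<omega>"
proof (cases "\<forall>e. e \<notin> F \<longrightarrow> \<omega> e = 0")
  case True
  then have "stress_apply V \<omega> h y = (if y \<in> W then stress_apply W \<omega> h y else 0)" for h y
    using stress_apply_extend[OF assms] by blast
  then show ?thesis
    using assms(2) unfolding is_stress_def by auto
qed (auto simp: is_stress_def)

text \<open>By contraposition. Let all stresses of \<open>G - uv\<close> at \<open>p\<close> be
  stresses at \<open>q\<close>. If \<open>uv\<close> is stress-linked in \<open>G' - uv\<close>,
  then a stress \<eta> of \<open>G'\<close> with nonzero value at \<open>uv\<close> is one at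
  \<open>q\<close> as well. Every stress of \<open>G\<close> is a multiple of \<eta> plus a stress
  of \<open>G - uv\<close>, so it follows suit.\<close>

lemma stress_independent_subgraph:
  assumes G: "simple_graph G" and sub: "subgraph_of G' G" and indep: "stress_independent d G"
  shows "stress_independent d G'"
  unfolding stress_independent_def
proof (intro allI impI notI)
  fix u v assume uv': "{u, v} \<in> edges G'" and L: "stress_linked d (del_edge G' u v) u v"
  have G': "simple_graph G'" and V': "verts G' \<subseteq> verts G" and E': "edges G' \<subseteq> edges G"
    using sub unfolding subgraph_of_def by auto
  note V = simple_graphD(1)[OF G]
  have uv: "{u, v} \<in> edges G" using uv' E' by blast
  have ext: "is_stress d (verts G) F p \<omega> \<longleftrightarrow> is_stress d (verts G') F p \<omega>"
    if "F \<subseteq> edges G'" for F p \<omega>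
    using is_stress_extend[OF V V', of F] that simple_graphD(2)[OF G'] by blast
  have stress: "\<exists>\<omega>. is_stress d (verts G) (edges G') p \<omega> \<and> \<omega> {u, v} \<noteq> 0"
    if p: "generic d (verts G) p" for p
    using L linked_iff[OF G' uv' generic_subset[OF p V' order_refl]] ext
    unfolding stress_linked_def by blast
  have "stress_linked d (del_edge G u v) u v"
    unfolding stress_linked_iff[OF G uv]
  proof (intro conjI allI impI; (elim conjE)?)
    let ?p = "generic_framework d (verts G)"
    have p: "generic d (verts G) ?p" by (rule generic_framework_generic[OF V])
    obtain \<omega> where "is_stress d (verts G) (edges G') ?p \<omega>" "\<omega> {u, v} \<noteq> 0"
      using stress[OF p] by blast
    then show "linked d (del_edge G u v) u v"
      using linked_iff[OF G uv p] is_stress_mono[OF _ E'] by blast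
  next
    fix p q \<omega>
    assume p: "generic d (verts G) p"
      and pq: "\<forall>\<omega>. is_stress d (verts G) (edges G - {{u, v}}) p \<omega> \<longrightarrow>
        is_stress d (verts G) (edges G - {{u, v}}) q \<omega>"
      and \<omega>: "is_stress d (verts G) (edges G) p \<omega>"
    have sub': "edges G' - {{u, v}} \<subseteq> edges G - {{u, v}}" "edges G' - {{u, v}} \<subseteq> edges G'"
      using E' by auto
    obtain \<eta> where \<eta>: "is_stress d (verts G) (edges G') p \<eta>" "\<eta> {u, v} \<noteq> 0"
      using stress[OF p] by blast
    have "is_stress d (verts G') (edges G' - {{u, v}}) q \<tau>"
      if \<tau>: "is_stress d (verts G') (edges G' - {{u, v}}) p \<tau>" for \<tau>
    proof -
      have \<tau>G: "is_stress d (verts G) (edges G' - {{u, v}}) p \<tau>"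
        using \<tau> ext[OF sub'(2)] by simp
      then have "is_stress d (verts G) (edges G - {{u, v}}) q \<tau>"
        using pq is_stress_mono[OF _ sub'(1)] by blast
      moreover have "\<tau> e = 0" if "e \<notin> edges G' - {{u, v}}" for e
        using \<tau> that unfolding is_stress_def by blast
      ultimately have "is_stress d (verts G) (edges G' - {{u, v}}) q \<tau>"
        unfolding is_stress_def by blast
      then show ?thesis using ext[OF sub'(2)] by simp
    qed
    moreover have "generic d (verts G') p" by (rule generic_subset[OF p V' order_refl])
    moreover have "is_stress d (verts G') (edges G') p \<eta>" using \<eta>(1) ext by blast
    ultimately have "is_stress d (verts G') (edges G') q \<eta>"
      using L unfolding stress_linked_iff[OF G' uv'] by blast
    then have \<eta>q: "is_stress d (verts G) (edges G) q \<eta>"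
      using ext[OF order_refl] is_stress_mono[OF _ E'] by blast
    define s where "s = \<omega> {u, v} / \<eta> {u, v}"
    have "is_stress d (verts G) (edges G - {{u, v}}) p (\<lambda>e. \<omega> e - s * \<eta> e)"
      by (rule is_stress_restrict[OF is_stress_diff_scale[OF \<omega> is_stress_mono[OF \<eta>(1) E']]])
        (use \<eta>(2) in \<open>auto simp: s_def\<close>)
    then have "is_stress d (verts G) (edges G - {{u, v}}) q (\<lambda>e. \<omega> e - s * \<eta> e)" using pq by blast
    then have "is_stress d (verts G) (edges G) q (\<lambda>e. \<omega> e - s * \<eta> e)"
      by (rule is_stress_mono) blast
    then have "is_stress d (verts G) (edges G) q (\<lambda>e. (\<omega> e - s * \<eta> e) - (- s) * \<eta> e)"
      by (rule is_stress_diff_scale[OF _ \<eta>q])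
    then show "is_stress d (verts G) (edges G) q \<omega>" by simp
  qed
  then show False using indep uv unfolding stress_independent_def by blast
qed

section \<open>Generic points and the count\<close>

text \<open>Induction that drops one point and one coordinate. By the induction hypothesis the
  dependences in all but the last coordinate form at most a line. Moving the last coordinate of one
  point \<open>w\<close> by 1 keeps the framework generic, so a dependence that involves
  \<open>w\<close> would have to survive, which the line does not allow.\<close>

lemma generic_affinely_independent:
  assumes "finite W" "card W \<le> Suc d" "generic d W p"
    and "(\<Sum>v\<in>W. c v) = (0 :: real)" "\<forall>i<d. (\<Sum>v\<in>W. c v * p v i) = 0"
  shows "\<forall>v\<in>W. c v = 0"
  using assms
proof (induction d arbitrary: W c)
  case 0
  then obtain w where "W \<subseteq> {w}"
    by (metis One_nat_def card_le_Suc0_iff_eq subsetI singletonI empty_subsetI ex_in_conv)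
  then show ?case using 0 by (auto simp: subset_singleton_iff)
next
  case (Suc d)
  show ?case
  proof (rule ccontr)
    assume "\<not> (\<forall>v\<in>W. c v = 0)"
    then obtain w where w: "w \<in> W" "c w \<noteq> 0" by blast
    \<comment> \<open>The difference \<open>b\<close> vanishes at \<open>w\<close>, so it is a
      dependence of one point fewer, to which the induction hypothesis applies.\<close>
    have proportional: "c' v = c' w / c w * c v"
      if c': "(\<Sum>v\<in>W. c' v) = 0" "\<forall>i<d. (\<Sum>v\<in>W. c' v * p v i) = 0" and v: "v \<in> W" for c' v
    proof -
      define b where "b v = c' v - c' w / c w * c v" for v
      have bw: "b w = 0" using w by (simp add: b_def)
      have "\<forall>v\<in>W - {w}. b v = 0"
      proof (rule Suc.IH)
        show "finite (W - {w})" "card (W - {w}) \<le> Suc d"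
          using Suc.prems(1,2) w(1) by simp_all
        show "generic d (W - {w}) p"
          by (rule generic_subset[OF Suc.prems(3)]) auto
        have "(\<Sum>v\<in>W. b v) = 0"
          unfolding b_def sum_subtractf sum_distrib_left[symmetric]
          using c'(1) Suc.prems(4) by simp
        then show "(\<Sum>v\<in>W - {w}. b v) = 0"
          using bw Suc.prems(1) w(1) by (simp add: sum.remove)
        show "\<forall>i<d. (\<Sum>v\<in>W - {w}. b v * p v i) = 0"
        proof (intro allI impI)
          fix i assume i: "i < d"
          have "(\<Sum>v\<in>W. b v * p v i) =
              (\<Sum>v\<in>W. c' v * p v i) - c' w / c w * (\<Sum>v\<in>W. c v * p v i)"
            unfolding b_def sum_distrib_left sum_subtractf[symmetric]
            by (intro sum.cong refl) (simp add: left_diff_distrib)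
          then have "(\<Sum>v\<in>W. b v * p v i) = 0"
            using c'(2) Suc.prems(5) i by simp
          then show "(\<Sum>v\<in>W - {w}. b v * p v i) = 0"
            using bw Suc.prems(1) w(1) by (simp add: sum.remove)
        qed
      qed
      then have "b v = 0" using bw v by auto
      then show ?thesis by (simp add: b_def)
    qed
    let ?h = "\<lambda>v. p v d"
    let ?q = "\<lambda>v i. if i = d then (?h(w := ?h w + 1)) v else p v i"
    have "(\<lambda>v i. if i = d then ?h v else p v i) = p" by (intro ext) simp
    then have q: "generic (Suc d) W ?q"
      using generic_shift[of d W ?h p w] Suc.prems(3) by simp
    \<comment> \<open>Row \<open>Suc d\<close> is constantly 1 and encodes that the coefficients sum
      to zero.\<close>
    let ?M = "\<lambda>i v x. if i < Suc d then x (v, i) else (1 :: real)"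
    have "\<exists>z. (\<forall>r\<in>{..Suc d}. (\<Sum>v\<in>W. z v * ?M r v (\<lambda>(v, i). ?q v i)) = 0) \<and> z w \<noteq> 0"
    proof (rule kernel_transfer[where x = "\<lambda>(v, i). p v i" and z = c and I = "W \<times> {..<Suc d}"
          and M = ?M and y = "\<lambda>(v, i). ?q v i" and R = "{..Suc d}" and J = W])
      show "qpolyfun (W \<times> {..<Suc d}) (?M r j)" if "r \<in> {..Suc d}" "j \<in> W" for r j
        using that by (cases "r < Suc d") (simp_all add: qpolyfun_var)
      show "alg_independent (W \<times> {..<Suc d}) (\<lambda>(v, i). p v i)"
        using Suc.prems(3) unfolding generic_def .
      show "alg_independent (W \<times> {..<Suc d}) (\<lambda>(v, i). ?q v i)"
        using q unfolding generic_def .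
      show "\<forall>r\<in>{..Suc d}. (\<Sum>v\<in>W. c v * ?M r v (\<lambda>(v, i). p v i)) = 0"
      proof
        fix r assume "r \<in> {..Suc d}"
        show "(\<Sum>v\<in>W. c v * ?M r v (\<lambda>(v, i). p v i)) = 0"
        proof (cases "r < Suc d")
          case True
          then show ?thesis using Suc.prems(5) by simp
        next
          case False
          then show ?thesis using Suc.prems(4) by simp
        qed
      qed
    qed (use Suc.prems(1) w in simp_all)
    then obtain c' where c': "\<forall>r\<in>{..Suc d}. (\<Sum>v\<in>W. c' v * ?M r v (\<lambda>(v, i). ?q v i)) = 0"
      and w': "c' w \<noteq> 0" by blast
    have c'1: "(\<Sum>v\<in>W. c' v) = 0" using bspec[OF c', of "Suc d"] by simp
    have c'i: "(\<Sum>v\<in>W. c' v * ?q v i) = 0" if "i < Suc d" for i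
      using bspec[OF c', of i] that by simp
    have "\<forall>i<d. (\<Sum>v\<in>W. c' v * p v i) = 0"
    proof (intro allI impI)
      fix i assume "i < d"
      then show "(\<Sum>v\<in>W. c' v * p v i) = 0" using c'i[of i] by simp
    qed
    note eq = proportional[OF c'1 this]
    \<comment> \<open>In the shifted coordinate \<open>c'\<close> yields the unshifted sum, which is
      zero because \<open>c'\<close> is a multiple of \<open>c\<close>, plus
      \<open>c' w\<close>.\<close>
    have "(\<Sum>v\<in>W. c' v * ?q v d) = (\<Sum>v\<in>W. c' v * p v d + c' v * (if v = w then 1 else 0))"
      by (intro sum.cong refl) (simp add: distrib_left)
    also have "\<dots> = (\<Sum>v\<in>W. c' v * p v d) + c' w"
      by (simp only: sum.distrib sum_mult_unit_vector[OF Suc.prems(1) w(1)])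
    also have "(\<Sum>v\<in>W. c' v * p v d) = (\<Sum>v\<in>W. c' w / c w * (c v * p v d))"
      by (rule sum.cong[OF refl]) (subst eq, simp_all)
    also have "\<dots> = 0"
      unfolding sum_distrib_left[symmetric] using Suc.prems(5) by simp
    finally show False using c'i[of d] w' by simp
  qed
qed

text \<open>Homogeneous coordinates: the constant one at index \<open>d\<close> turns affine
  dependences of points into linear ones.\<close>

definition hom_coord :: "nat \<Rightarrow> 'a framework \<Rightarrow> nat \<Rightarrow> 'a \<Rightarrow> real" where
  "hom_coord d p i v = (if i < d then p v i else 1)"

lemma hom_coord_affinely_independent:
  assumes "finite W" "card W \<le> Suc d" "generic d W p"
    and "\<forall>i\<le>d. (\<Sum>v\<in>W. c v * hom_coord d p i v) = 0"
  shows "\<forall>v\<in>W. c v = 0"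
proof (rule generic_affinely_independent[OF assms(1-3)])
  show "(\<Sum>v\<in>W. c v) = 0" using assms(4) by (auto simp: hom_coord_def dest: spec[of _ d])
  show "\<forall>i<d. (\<Sum>v\<in>W. c v * p v i) = 0"
  proof (intro allI impI)
    fix i assume "i < d"
    then show "(\<Sum>v\<in>W. c v * p v i) = 0"
      using spec[OF assms(4), of i] by (simp add: hom_coord_def)
  qed
qed

text \<open>Row rank against column rank: \<open>d + 1\<close> of the points have independent
  vectors of \<open>d + 1\<close> homogeneous coordinates, which leaves no room for a nonzero
  \<open>a\<close> orthogonal to them all.\<close>

lemma lin_indep_hom_coord:
  assumes "finite V" "Suc d \<le> card V" "generic d V p"
  shows "lin_indep {..d} V (hom_coord d p)"
  unfolding lin_indep_def
proof (rule ccontr)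
  assume "\<not> (\<forall>a. (\<forall>v\<in>V. (\<Sum>i\<le>d. a i * hom_coord d p i v) = 0) \<longrightarrow> (\<forall>i\<in>{..d}. a i = 0))"
  then obtain a k where a: "\<forall>v\<in>V. (\<Sum>i\<le>d. a i * hom_coord d p i v) = 0"
    and k: "k \<le> d" "a k \<noteq> 0" by auto
  obtain W where W: "W \<subseteq> V" "card W = Suc d" "finite W"
    using obtain_subset_with_card_n[OF assms(2)] assms(1) by (metis finite_subset)
  have "card W + card {0 :: nat} \<le> card {..d}"
  proof (rule lin_indep_orthogonal_card)
    show "lin_indep W {..d} (\<lambda>v i. hom_coord d p i v)"
      unfolding lin_indep_def
    proof (intro allI impI)
      fix c assume "\<forall>i\<in>{..d}. (\<Sum>v\<in>W. c v * hom_coord d p i v) = 0"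
      then show "\<forall>v\<in>W. c v = 0"
        using W generic_subset[OF assms(3) W(1)]
        by (intro hom_coord_affinely_independent[of W d p]) simp_all
    qed
    show "lin_indep {0 :: nat} {..d} (\<lambda>_. a)"
      unfolding lin_indep_def
    proof (intro allI impI ballI)
      fix b :: "nat \<Rightarrow> real" and i :: nat
      assume "\<forall>i\<in>{..d}. (\<Sum>j\<in>{0}. b j * a i) = 0" "i \<in> {0}"
      then show "b i = 0" using k by auto
    qed
    show "(\<Sum>i\<le>d. hom_coord d p i v * a i) = 0" if "v \<in> W" for v
      using a W(1) that by (auto simp: mult.commute)
  qed (use W in simp_all)
  then show False using W by simp
qed

lemma stress_apply_hom_coord:
  assumes "is_stress d V F p \<omega>" "y \<in> V"
  shows "stress_apply V \<omega> (hom_coord d p i) y = 0"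
proof (cases "i < d")
  case True
  then have "hom_coord d p i = (\<lambda>x. p x i)" by (intro ext) (simp add: hom_coord_def)
  then show ?thesis using assms True unfolding is_stress_def by simp
next
  case False
  then have "hom_coord d p i = (\<lambda>x. 1)" by (intro ext) (simp add: hom_coord_def)
  then show ?thesis by simp
qed

lemma stress_apply_orthogonal_hom_coord:
  assumes "is_stress d V F p \<omega>"
  shows "(\<Sum>v\<in>V. stress_apply V \<omega> h v * hom_coord d p i v) = 0"
  using stress_apply_symmetric[of "hom_coord d p i" V \<omega> h] stress_apply_hom_coord[OF assms]
  by (simp add: mult.commute)

text \<open>Each edge outside a base closes a circuit with it, and the normalised stress of that
  circuit vanishes on all other edges outside the base. This gives
  \<open>card (edges G) - rigidity_rank d G\<close> independent stresses.\<close>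

lemma fundamental_stresses:
  assumes G: "simple_graph G" and p: "generic d (verts G) p"
  obtains F W where "F \<subseteq> edges G" "card F = rigidity_rank d G" "stress_free d (verts G) F p"
    "\<And>f. f \<in> edges G - F \<Longrightarrow> is_stress d (verts G) (edges G) p (W f)"
    "\<And>f g. f \<in> edges G - F \<Longrightarrow> g \<in> edges G - F \<Longrightarrow> W f g = (if g = f then 1 else 0)"
proof -
  obtain F where F: "F \<subseteq> edges G" "stress_free d (verts G) F p" "card F = rigidity_rank d G"
    and ex: "\<forall>f\<in>edges G - F. \<exists>\<omega>. is_stress d (verts G) (insert f F) p \<omega> \<and> \<omega> f = 1"
    by (rule rigidity_base[OF G p])
  from bchoice[OF ex] obtain W where
    W: "\<And>f. f \<in> edges G - F \<Longrightarrow> is_stress d (verts G) (insert f F) p (W f)"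
      "\<And>f. f \<in> edges G - F \<Longrightarrow> W f f = 1"
    by blast
  show ?thesis
  proof (rule that[OF F(1,3,2)])
    show "is_stress d (verts G) (edges G) p (W f)" if "f \<in> edges G - F" for f
      by (rule is_stress_mono[OF W(1)[OF that]]) (use F(1) that in auto)
    fix f g assume f: "f \<in> edges G - F" and g: "g \<in> edges G - F"
    have "\<forall>e. e \<notin> insert f F \<longrightarrow> W f e = 0"
      using W(1)[OF f] unfolding is_stress_def by (rule conjunct1)
    then show "W f g = (if g = f then 1 else 0)"
      using W(2)[OF f] g by simp
  qed
qed

lemma rigidity_independent_card_bound:
  assumes G: "simple_graph G" and n: "Suc d \<le> card (verts G)"
    and indep: "rigidity_independent (Suc d) G"
  shows "card (edges G) + Suc d \<le> rigidity_rank d G + card (verts G)"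
proof -
  let ?V = "verts G"
  let ?P = "generic_framework (Suc d) ?V"
  note V = simple_graphD(1)[OF G]
  have P: "generic (Suc d) ?V ?P" by (rule generic_framework_generic[OF V])
  then have p: "generic d ?V ?P" by (rule generic_subset) auto
  have free: "stress_free (Suc d) ?V (edges G) ?P"
    using indep rigidity_indep_set_iff[OF G P] unfolding rigidity_independent_def by simp
  obtain F W where F: "F \<subseteq> edges G" "card F = rigidity_rank d G"
    and W: "\<And>f. f \<in> edges G - F \<Longrightarrow> is_stress d ?V (edges G) ?P (W f)"
      "\<And>f g. f \<in> edges G - F \<Longrightarrow> g \<in> edges G - F \<Longrightarrow> W f g = (if g = f then 1 else 0)"
    by (rule fundamental_stresses[OF G p]) blast
  let ?B = "edges G - F"
  have finB: "finite ?B" using simple_graphD(3)[OF G] by simp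
  \<comment> \<open>\<open>?P\<close> is generic in dimension d + 1: its first \<open>d\<close>
    coordinates act as \<open>p\<close> and the last one as \<open>h\<close>.\<close>
  let ?h = "\<lambda>v. ?P v d"
  have "card ?B + card {..d} \<le> card ?V"
  proof (rule lin_indep_orthogonal_card[OF V finB])
    show "lin_indep {..d} ?V (hom_coord d ?P)" by (rule lin_indep_hom_coord[OF V n p])
    show "(\<Sum>v\<in>?V. stress_apply ?V (W f) ?h v * hom_coord d ?P i v) = 0" if "f \<in> ?B" for f i
      by (rule stress_apply_orthogonal_hom_coord[OF W(1)[OF that]])
    show "lin_indep ?B ?V (\<lambda>f. stress_apply ?V (W f) ?h)"
      unfolding lin_indep_def
    proof (intro allI impI ballI)
      fix a g assume a: "\<forall>v\<in>?V. (\<Sum>f\<in>?B. a f * stress_apply ?V (W f) ?h v) = 0" and g: "g \<in> ?B"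
      define \<omega> where "\<omega> e = (\<Sum>f\<in>?B. a f * W f e)" for e
      have "is_stress d ?V (edges G) ?P \<omega>"
        unfolding \<omega>_def by (rule is_stress_sum) (rule W(1))
      moreover have "stress_apply ?V \<omega> ?h v = 0" if "v \<in> ?V" for v
        using a that unfolding \<omega>_def stress_apply_sum_stress by simp
      ultimately have "is_stress (Suc d) ?V (edges G) ?P \<omega>"
        unfolding is_stress_def by (simp add: less_Suc_eq)
      then have "\<omega> g = 0" using free unfolding stress_free_def by blast
      moreover have "\<omega> g = (\<Sum>f\<in>?B. a f * (if f = g then 1 else 0))"
        unfolding \<omega>_def by (rule sum.cong) (use W(2) g in auto)
      ultimately show "a g = 0"
        by (simp only: sum_mult_unit_vector[OF finB g])
    qed
  qed simp
  moreover have "card (edges G) = card F + card ?B"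
    using card_Diff_subset[OF finite_subset[OF F(1)] F(1)] card_mono[OF _ F(1)]
      simple_graphD(3)[OF G] by simp
  ultimately show ?thesis using F(2) by simp
qed

section \<open>Infinitesimal isometries and the rank bound\<close>

lemma card_pairs_below: "card (SIGMA b:{..d}. {..<b}) = Suc d choose 2"
proof -
  have "card (SIGMA b:{..d}. {..<b}) = (\<Sum>b\<le>d. b)" by simp
  also have "\<dots> = Suc d choose 2"
    by (induction d) (simp_all add: numeral_2_eq_2)
  finally show ?thesis .
qed

text \<open>
  The infinitesimal rotation in the plane of coordinates \<open>a < b < d\<close>; for \<open>b = d\<close>
  it is a translation, since the homogeneous coordinate \<open>d\<close> is constant.
\<close>

definition rigid_motion :: "nat \<Rightarrow> 'a framework \<Rightarrow> nat \<times> nat \<Rightarrow> 'a \<times> nat \<Rightarrow> real" where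
  "rigid_motion d p = (\<lambda>(b, a) (v, j).
     (if j = b then hom_coord d p a v else 0) - (if j = a then hom_coord d p b v else 0))"

text \<open>In coordinate \<open>j\<close> a combination of the motions is a combination of the
  homogeneous coordinates whose coefficients form one row of a skew-symmetric matrix; independence
  of these coordinates makes the row zero.\<close>

lemma lin_indep_rigid_motion:
  assumes hc: "lin_indep {..d} V (hom_coord d p)"
  shows "lin_indep (SIGMA b:{..d}. {..<b}) (V \<times> {..<d}) (rigid_motion d p)"
  unfolding lin_indep_def
proof (intro allI impI ballI)
  let ?I = "SIGMA b:{..d}. {..<b}"
  fix s k
  assume s: "\<forall>x\<in>V \<times> {..<d}. (\<Sum>i\<in>?I. s i * rigid_motion d p i x) = 0" and "k \<in> ?I"
  then obtain b0 j where k: "k = (b0, j)" "b0 \<le> d" "j < b0" by auto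
  \<comment> \<open>The row with index \<open>j\<close>. As \<open>j < b0\<close>, the coefficient
    sought is \<open>- t b0\<close>; and \<open>j < d\<close> even for \<open>b0 = d\<close>, so
    \<open>j\<close> is a genuine coordinate.\<close>
  define t where "t i = (if i < j then s (j, i) else 0) - (if j < i then s (i, j) else 0)" for i
  have "(\<Sum>i\<le>d. t i * hom_coord d p i v) = 0" if v: "v \<in> V" for v
  proof -
    let ?c = "\<lambda>i. hom_coord d p i v"
    have "0 = (\<Sum>i\<in>?I. s i * rigid_motion d p i (v, j))"
      using bspec[OF s, of "(v, j)"] v k by simp
    also have "\<dots> = (\<Sum>(b, a)\<in>?I. s (b, a) * ((if j = b then ?c a else 0) - (if j = a then ?c b else 0)))"
      by (rule sum.cong) (auto simp: rigid_motion_def)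
    also have "\<dots> = (\<Sum>b\<le>d. \<Sum>a<b. s (b, a) * ((if j = b then ?c a else 0) - (if j = a then ?c b else 0)))"
      by (rule sum.Sigma[symmetric]) auto
    also have "\<dots> = (\<Sum>b\<le>d. \<Sum>a<b. s (b, a) * (if j = b then ?c a else 0)) -
        (\<Sum>b\<le>d. \<Sum>a<b. s (b, a) * (if j = a then ?c b else 0))"
      by (simp only: right_diff_distrib sum_subtractf)
    also have "(\<Sum>b\<le>d. \<Sum>a<b. s (b, a) * (if j = b then ?c a else 0)) =
        (\<Sum>b\<le>d. if j = b then \<Sum>a<b. s (b, a) * ?c a else 0)"
      by (intro sum.cong refl) simp
    also have "\<dots> = (\<Sum>a<j. s (j, a) * ?c a)"
      using k by (subst sum.delta') auto
    also have "\<dots> = (\<Sum>i\<le>d. (if i < j then s (j, i) else 0) * ?c i)"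
      by (rule sum.mono_neutral_cong_left) (use k in auto)
    also have "(\<Sum>b\<le>d. \<Sum>a<b. s (b, a) * (if j = a then ?c b else 0)) =
        (\<Sum>b\<le>d. (if j < b then s (b, j) else 0) * ?c b)"
    proof (intro sum.cong refl)
      fix b
      have "(\<Sum>a<b. s (b, a) * (if j = a then ?c b else 0)) = (\<Sum>a<b. if j = a then s (b, a) * ?c b else 0)"
        by (intro sum.cong refl) simp
      then show "(\<Sum>a<b. s (b, a) * (if j = a then ?c b else 0)) = (if j < b then s (b, j) else 0) * ?c b"
        by simp
    qed
    finally show ?thesis
      unfolding t_def left_diff_distrib sum_subtractf by simp
  qed
  then have "\<forall>i\<in>{..d}. t i = 0"
    using hc unfolding lin_indep_def by blast
  then show "s k = 0" using k by (auto simp: t_def dest: bspec[of _ _ b0])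
qed

text \<open>The rows of the rigidity matrix are orthogonal to the infinitesimal isometries, and both
  live in a space of dimension \<open>d * card (verts G)\<close>.\<close>

lemma rigidity_rank_le:
  assumes G: "simple_graph G" and n: "Suc d \<le> card (verts G)"
  shows "rigidity_rank d G + (Suc d choose 2) \<le> d * card (verts G)"
proof -
  let ?V = "verts G"
  let ?p = "generic_framework d ?V"
  let ?I = "SIGMA b:{..d}. {..<b}"
  note V = simple_graphD(1)[OF G]
  have p: "generic d ?V ?p" by (rule generic_framework_generic[OF V])
  obtain F where F: "F \<subseteq> edges G" "stress_free d ?V F ?p" "card F = rigidity_rank d G"
    by (rule rigidity_base[OF G p])
  have finF: "finite F" using F(1) simple_graphD(3)[OF G] finite_subset by blast
  have FV: "F \<subseteq> nsets ?V 2" using F(1) simple_graphD(2)[OF G] by blast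
  have "card F + card ?I \<le> card (?V \<times> {..<d})"
  proof (rule lin_indep_orthogonal_card)
    have "rows_independent d ?V ?p F"
      using F(2) unfolding rows_independent_iff[OF V FV] stress_free_def .
    then show "lin_indep F (?V \<times> {..<d}) (\<lambda>e (v, i). rigidity_matrix ?p e v i)"
      unfolding rows_independent_def lin_indep_def by (simp add: Ball_def)
    show "lin_indep ?I (?V \<times> {..<d}) (rigid_motion d ?p)"
      by (rule lin_indep_rigid_motion[OF lin_indep_hom_coord[OF V n p]])
    fix e k assume e: "e \<in> F" and "k \<in> ?I"
    then obtain b a where k: "k = (b, a)" "b \<le> d" "a < b" by auto
    have "e \<in> nsets ?V 2" using e FV by blast
    then obtain x y where xy: "e = {x, y}" "x \<in> ?V" "y \<in> ?V" "x \<noteq> y" by (rule nsets_2_E)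
    define D where "D i = hom_coord d ?p i x - hom_coord d ?p i y" for i
    have "(\<Sum>z\<in>?V \<times> {..<d}. (case z of (v, i) \<Rightarrow> rigidity_matrix ?p e v i) * rigid_motion d ?p k z) =
        (\<Sum>(v, i)\<in>?V \<times> {..<d}. rigidity_matrix ?p e v i * rigid_motion d ?p k (v, i))"
      by (rule sum.cong) auto
    also have "\<dots> = (\<Sum>i<d. \<Sum>v\<in>?V. rigidity_matrix ?p e v i * rigid_motion d ?p k (v, i))"
      unfolding sum.cartesian_product[symmetric] by (rule sum.swap)
    \<comment> \<open>The motion acts on the edge vector by a skew-symmetric matrix: the terms for
      \<open>i = b\<close> and \<open>i = a\<close> cancel. For \<open>b = d\<close> only the second
      is present, and it is zero since \<open>D d = 0\<close>.\<close>
    also have "\<dots> = (\<Sum>i<d. D i * ((if i = b then D a else 0) - (if i = a then D b else 0)))"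
    proof (rule sum.cong[OF refl])
      fix i assume "i \<in> {..<d}"
      then have "?p x i - ?p y i = D i" by (simp add: D_def hom_coord_def)
      then show "(\<Sum>v\<in>?V. rigidity_matrix ?p e v i * rigid_motion d ?p k (v, i)) =
          D i * ((if i = b then D a else 0) - (if i = a then D b else 0))"
        unfolding xy(1) rigidity_matrix_row_sum[OF V xy(2-4)]
        by (simp add: rigid_motion_def k(1) D_def)
    qed
    also have "\<dots> = (\<Sum>i<d. if i = b then D i * D a else 0) - (\<Sum>i<d. if i = a then D i * D b else 0)"
      unfolding right_diff_distrib sum_subtractf by (intro arg_cong2[of _ _ _ _ "(-)"] sum.cong) auto
    also have "\<dots> = 0"
    proof (cases "b < d")
      case True
      then show ?thesis using k by (simp add: mult.commute)
    next
      case False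
      then have "D b = 0" by (simp add: D_def hom_coord_def)
      then show ?thesis using False k by simp
    qed
    finally show "(\<Sum>z\<in>?V \<times> {..<d}. (case z of (v, i) \<Rightarrow> rigidity_matrix ?p e v i) *
      rigid_motion d ?p k z) = 0" .
  qed (use V finF in auto)
  then show ?thesis
    unfolding card_pairs_below F(3) by (simp add: card_cartesian_product mult.commute)
qed

section \<open>The equality case\<close>

text \<open>One spanning family, polynomial in the framework, for all generic frameworks at once.
  The index set \<open>F\<close> is inherited from \<open>kernel_basis\<close>, which indexes by the
  unknowns.\<close>

lemma stress_basis:
  assumes V: "finite V" and F: "F \<subseteq> nsets V 2"
  obtains W where "\<And>i e. i \<in> F \<Longrightarrow> qpolyfun (V \<times> {..<d}) (W i e)"
    and "\<And>p i. generic d V p \<Longrightarrow> i \<in> F \<Longrightarrow> is_stress d V F p (\<lambda>e. W i e (\<lambda>(v, i). p v i))"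
    and "\<And>p \<omega>. generic d V p \<Longrightarrow> is_stress d V F p \<omega> \<Longrightarrow>
      \<exists>a. \<omega> = (\<lambda>e. \<Sum>i\<in>F. a i * W i e (\<lambda>(v, i). p v i))"
proof -
  let ?I = "V \<times> {..<d}"
  let ?M = "\<lambda>r e x. rigidity_matrix (\<lambda>v i. x (v, i)) e (fst r) (snd r)"
  have finF: "finite F"
    using V F by (auto intro: finite_subset finite_imp_finite_nsets)
  have "\<exists>Z. kernel_basis ?I ?I F ?M Z"
  proof (rule polynomial_kernel_basis)
    fix r e assume "r \<in> ?I" "e \<in> F"
    then show "qpolyfun ?I (?M r e)"
      using F by (intro qpolyfun_rigidity_matrix) auto
  qed (use V finF in auto)
  then obtain Z where Z: "kernel_basis ?I ?I F ?M Z" ..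
  define W where "W i e = (if e \<in> F then Z i e else (\<lambda>x. 0))" for i e
  show thesis
  proof (rule that)
    show "qpolyfun ?I (W i e)" if "i \<in> F" for i e
      using kernel_basis_qpolyfun[OF Z that] by (simp add: W_def)
  next
    fix p i assume p: "generic d V p" and i: "i \<in> F"
    let ?x = "\<lambda>(v, i). p v i"
    have x: "alg_independent ?I ?x" using p unfolding generic_def .
    have "(\<Sum>e\<in>F. Z i e ?x * rigidity_matrix p e v j) = 0" if "v \<in> V" "j < d" for v j
      using kernel_basis_member[OF Z x finF i, of "(v, j)"] that by simp
    then have "is_stress d V F p (\<lambda>e. if e \<in> F then Z i e ?x else 0)"
      by (intro is_stress_of_rows[OF V F]) blast
    moreover have "(\<lambda>e. if e \<in> F then Z i e ?x else 0) = (\<lambda>e. W i e ?x)"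
      by (rule ext) (simp add: W_def)
    ultimately show "is_stress d V F p (\<lambda>e. W i e ?x)" by simp
  next
    fix p \<omega> assume p: "generic d V p" and \<omega>: "is_stress d V F p \<omega>"
    let ?x = "\<lambda>(v, i). p v i"
    have x: "alg_independent ?I ?x" using p unfolding generic_def .
    have off: "\<omega> e = 0" if "e \<notin> F" for e
      using \<omega> that unfolding is_stress_def by blast
    have "\<forall>r\<in>?I. (\<Sum>e\<in>F. \<omega> e * ?M r e ?x) = 0"
      using \<omega> is_stress_iff_rows[OF V F off] by auto
    then obtain a where a: "\<forall>e\<in>F. \<omega> e = (\<Sum>i\<in>F. a i * Z i e ?x)"
      unfolding kernel_basis_span[OF Z x] ..
    have "\<omega> = (\<lambda>e. \<Sum>i\<in>F. a i * W i e ?x)"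
    proof
      fix e show "\<omega> e = (\<Sum>i\<in>F. a i * W i e ?x)"
        by (cases "e \<in> F") (simp_all add: a off W_def)
    qed
    then show "\<exists>a. \<omega> = (\<lambda>e. \<Sum>i\<in>F. a i * W i e ?x)" by (intro exI[of _ a])
  qed
qed

lemma stress_apply_unit_vectors:
  assumes "finite V" "y \<in> V"
  shows "(\<Sum>z\<in>V. h z * stress_apply V \<omega> (\<lambda>v. if v = z then 1 else 0) y) = stress_apply V \<omega> h y"
  unfolding stress_apply_sum_point[symmetric]
proof (rule stress_apply_cong)
  fix v assume "v \<in> V"
  then show "(\<Sum>z\<in>V. h z * (if v = z then 1 else 0)) = h v"
    using sum_mult_unit_vector(1)[OF assms(1), of v h] by (simp add: eq_commute)
qed (rule assms)

text \<open>
  Both the stresses and the configurations annihilated by them are spanned by vectors that are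
  polynomial in the generic point.
\<close>

lemma separating_configuration_transfer:
  assumes V: "finite V" and E: "E \<subseteq> nsets V 2" and F: "F \<subseteq> nsets V 2"
    and q: "generic d V q" and p: "generic d V p"
    and kill: "\<And>\<tau> y. is_stress d V F q \<tau> \<Longrightarrow> y \<in> V \<Longrightarrow> stress_apply V \<tau> h y = 0"
    and \<omega>: "is_stress d V E q \<omega>" and y: "y \<in> V" "stress_apply V \<omega> h y \<noteq> 0"
  obtains h' \<omega>' where
    "\<And>\<tau> y. is_stress d V F p \<tau> \<Longrightarrow> y \<in> V \<Longrightarrow> stress_apply V \<tau> h' y = 0"
    "is_stress d V E p \<omega>'" "stress_apply V \<omega>' h' y \<noteq> 0"
proof -
  let ?I = "V \<times> {..<d}"
  let ?x = "\<lambda>(v, i). q v i" and ?y = "\<lambda>(v, i). p v i"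
  have x: "alg_independent ?I ?x" using q unfolding generic_def .
  have y': "alg_independent ?I ?y" using p unfolding generic_def .
  have fin: "finite F" "finite E"
    using V E F by (auto intro: finite_subset finite_imp_finite_nsets)
  obtain W where Wp: "\<And>i e. i \<in> E \<Longrightarrow> qpolyfun ?I (W i e)"
    and W: "\<And>p i. generic d V p \<Longrightarrow> i \<in> E \<Longrightarrow> is_stress d V E p (\<lambda>e. W i e (\<lambda>(v, i). p v i))"
    and Wspan: "\<And>p \<omega>. generic d V p \<Longrightarrow> is_stress d V E p \<omega> \<Longrightarrow>
      \<exists>a. \<omega> = (\<lambda>e. \<Sum>i\<in>E. a i * W i e (\<lambda>(v, i). p v i))"
    by (rule stress_basis[OF V E, where d = d]) blast
  obtain Y where Yp: "\<And>i e. i \<in> F \<Longrightarrow> qpolyfun ?I (Y i e)"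
    and Y: "\<And>p i. generic d V p \<Longrightarrow> i \<in> F \<Longrightarrow> is_stress d V F p (\<lambda>e. Y i e (\<lambda>(v, i). p v i))"
    and Yspan: "\<And>p \<omega>. generic d V p \<Longrightarrow> is_stress d V F p \<omega> \<Longrightarrow>
      \<exists>a. \<omega> = (\<lambda>e. \<Sum>i\<in>F. a i * Y i e (\<lambda>(v, i). p v i))"
    by (rule stress_basis[OF V F, where d = d]) blast
  \<comment> \<open>The linear system for configurations annihilated by the stresses
    \<open>Y\<close>: the coefficient at \<open>z\<close> is the action on the unit vector at
    \<open>z\<close>, which is polynomial because \<open>Y\<close> is.\<close>
  let ?N = "\<lambda>r z x. stress_apply V (\<lambda>e. Y (fst r) e x) (\<lambda>v. if v = z then 1 else 0) (snd r)"
  have "\<exists>H. kernel_basis ?I (F \<times> V) V ?N H"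
  proof (rule polynomial_kernel_basis)
    fix r z assume "r \<in> F \<times> V" "z \<in> V"
    then have "fst r \<in> F" by auto
    have c: "qpolyfun ?I (\<lambda>x. (if v = z then 1 else 0) - (if snd r = z then 1 else 0 :: real))" for v
      using qpolyfun_const[of ?I "(if v = z then 1 else 0) - (if snd r = z then 1 else 0)"]
      by (simp split: if_splits)
    show "qpolyfun ?I (?N r z)"
      unfolding stress_apply_def
      by (rule qpolyfun_sum, rule qpolyfun_mult, rule Yp[OF \<open>fst r \<in> F\<close>], rule c)
  qed (use V fin in auto)
  then obtain H where H: "kernel_basis ?I (F \<times> V) V ?N H" ..
  have N: "(\<Sum>z\<in>V. g z * ?N r z x) = stress_apply V (\<lambda>e. Y (fst r) e x) g (snd r)"
    if "r \<in> F \<times> V" for g r x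
    by (rule stress_apply_unit_vectors[OF V]) (use that in auto)
  have "\<forall>r\<in>F \<times> V. (\<Sum>z\<in>V. h z * ?N r z ?x) = 0"
  proof
    fix r assume r: "r \<in> F \<times> V"
    show "(\<Sum>z\<in>V. h z * ?N r z ?x) = 0"
      unfolding N[OF r] by (rule kill) (use Y[OF q] r in auto)
  qed
  then obtain a where a: "\<forall>v\<in>V. h v = (\<Sum>z\<in>V. a z * H z v ?x)"
    unfolding kernel_basis_span[OF H x] ..
  obtain b where b: "\<omega> = (\<lambda>e. \<Sum>i\<in>E. b i * W i e ?x)"
    using Wspan[OF q \<omega>] ..
  \<comment> \<open>Once \<open>h\<close> and \<omega> are expanded in the spanning families, some
    single pair of members acts nontrivially at \<open>y\<close>; this value is a polynomial in the
    point, hence nonzero at \<open>p\<close> too.\<close>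
  have "stress_apply V \<omega> h y = stress_apply V \<omega> (\<lambda>v. \<Sum>z\<in>V. a z * H z v ?x) y"
    by (rule stress_apply_cong) (use a y(1) in auto)
  also have "\<dots> = (\<Sum>i\<in>E. b i * (\<Sum>z\<in>V. a z * stress_apply V (\<lambda>e. W i e ?x) (\<lambda>v. H z v ?x) y))"
    unfolding b stress_apply_sum_stress stress_apply_sum_point ..
  finally have "(\<Sum>i\<in>E. b i * (\<Sum>z\<in>V. a z * stress_apply V (\<lambda>e. W i e ?x) (\<lambda>v. H z v ?x) y)) \<noteq> 0"
    using y(2) by simp
  then obtain i where i: "i \<in> E"
    "(\<Sum>z\<in>V. a z * stress_apply V (\<lambda>e. W i e ?x) (\<lambda>v. H z v ?x) y) \<noteq> 0"
    by (rule sum.not_neutral_contains_not_neutral) auto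
  from i(2) obtain z where z: "z \<in> V" "stress_apply V (\<lambda>e. W i e ?x) (\<lambda>v. H z v ?x) y \<noteq> 0"
    by (rule sum.not_neutral_contains_not_neutral) auto
  let ?f = "\<lambda>x. stress_apply V (\<lambda>e. W i e x) (\<lambda>v. H z v x) y"
  have "qpolyfun ?I ?f"
    unfolding stress_apply_def
  proof (rule qpolyfun_sum, rule qpolyfun_mult, rule Wp[OF i(1)], rule qpolyfun_diff)
    fix v assume "v \<in> V"
    then show "qpolyfun ?I (\<lambda>x. H z v x)" by (rule kernel_basis_qpolyfun[OF H z(1)])
    show "qpolyfun ?I (\<lambda>x. H z y x)" by (rule kernel_basis_qpolyfun[OF H z(1) y(1)])
  qed
  then have nz: "?f ?y \<noteq> 0"
    using alg_independent_vanishing[of ?I ?y ?f ?x] y' z(2) by blast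
  show thesis
  proof (rule that[OF _ W[OF p i(1)] nz])
    fix \<tau> u assume \<tau>: "is_stress d V F p \<tau>" and u: "u \<in> V"
    obtain c where c: "\<tau> = (\<lambda>e. \<Sum>i\<in>F. c i * Y i e ?y)"
      using Yspan[OF p \<tau>] ..
    have "stress_apply V (\<lambda>e. Y j e ?y) (\<lambda>v. H z v ?y) u = 0" if "j \<in> F" for j
      using kernel_basis_member[OF H y' V z(1), of "(j, u)"] N[of "(j, u)" "\<lambda>v. H z v ?y" ?y] that u
      by simp
    then show "stress_apply V \<tau> (\<lambda>v. H z v ?y) u = 0"
      unfolding c stress_apply_sum_stress by simp
  qed
qed

text \<open>Failure of stress-linkedness supplies, at some generic \<open>q\<close> and by transfer
  at \<open>p\<close>, a vector \<open>h\<close> annihilated by the stresses that vanish at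
  \<open>e\<close> but not by all stresses. So \<omega> \<mapsto> \<omega> h factors through the
  value \<omega> e.\<close>

lemma stress_independent_rank_one:
  assumes G: "simple_graph G" and indep: "stress_independent d G" and p: "generic d (verts G) p"
    and \<omega>0: "is_stress d (verts G) (edges G) p \<omega>0" "\<omega>0 e \<noteq> 0"
  obtains h c where "\<exists>y\<in>verts G. c y \<noteq> 0"
    "\<And>\<omega> y. is_stress d (verts G) (edges G) p \<omega> \<Longrightarrow> y \<in> verts G \<Longrightarrow>
      stress_apply (verts G) \<omega> h y = \<omega> e * c y"
proof -
  let ?V = "verts G"
  let ?E = "edges G"
  note V = simple_graphD(1)[OF G] and E = simple_graphD(2)[OF G]
  have e: "e \<in> ?E" using \<omega>0 unfolding is_stress_def by blast
  then obtain u v where uv: "e = {u, v}" using E by (blast elim: nsets_2_E)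
  then have uvE: "{u, v} \<in> ?E" using e by simp
  have "linked d (del_edge G u v) u v"
    using linked_iff[OF G uvE p] \<omega>0 uv by blast
  moreover have "\<not> stress_linked d (del_edge G u v) u v"
    using indep uvE unfolding stress_independent_def by blast
  ultimately have "\<not> (\<forall>q r. generic d ?V q \<and>
        (\<forall>\<omega>. is_stress d ?V (?E - {{u, v}}) q \<omega> \<longrightarrow> is_stress d ?V (?E - {{u, v}}) r \<omega>) \<longrightarrow>
      (\<forall>\<omega>. is_stress d ?V ?E q \<omega> \<longrightarrow> is_stress d ?V ?E r \<omega>))"
    unfolding stress_linked_iff[OF G uvE] de_Morgan_conj by (elim disjE) (erule notE, assumption)
  then obtain q r \<omega> where q: "generic d ?V q"
    and qr: "\<forall>\<omega>. is_stress d ?V (?E - {{u, v}}) q \<omega> \<longrightarrow> is_stress d ?V (?E - {{u, v}}) r \<omega>"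
    and \<omega>: "is_stress d ?V ?E q \<omega>" "\<not> is_stress d ?V ?E r \<omega>"
    unfolding not_all not_imp by (elim exE conjE)
  from \<omega> obtain i y where i: "i < d" and y: "y \<in> ?V" "stress_apply ?V \<omega> (\<lambda>x. r x i) y \<noteq> 0"
    unfolding is_stress_def by blast
  have E': "?E - {{u, v}} \<subseteq> nsets ?V 2" using E by blast
  have kill: "stress_apply ?V \<tau> (\<lambda>x. r x i) y = 0" if "is_stress d ?V (?E - {{u, v}}) q \<tau>" "y \<in> ?V" for \<tau> y
    by (rule is_stress_apply[OF mp[OF spec[OF qr] that(1)] that(2) i])
  obtain h \<omega>1 where h: "\<And>\<tau> y. is_stress d ?V (?E - {{u, v}}) p \<tau> \<Longrightarrow> y \<in> ?V \<Longrightarrow> stress_apply ?V \<tau> h y = 0"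
    and \<omega>1: "is_stress d ?V ?E p \<omega>1" "stress_apply ?V \<omega>1 h y \<noteq> 0"
    by (rule separating_configuration_transfer[OF V E E' q p kill \<omega>(1) y],
        assumption, assumption) (rule that)
  define c where "c y = stress_apply ?V \<omega>0 h y / \<omega>0 e" for y
  have c: "stress_apply ?V \<omega> h y = \<omega> e * c y" if \<omega>: "is_stress d ?V ?E p \<omega>" and y: "y \<in> ?V" for \<omega> y
  proof -
    have "is_stress d ?V (?E - {{u, v}}) p (\<lambda>x. \<omega> x - \<omega> e / \<omega>0 e * \<omega>0 x)"
      by (rule is_stress_restrict[OF is_stress_diff_scale[OF \<omega> \<omega>0(1)]]) (use \<omega>0(2) uv in auto)
    from h[OF this y] show ?thesis
      unfolding stress_apply_diff_scale by (simp add: c_def)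
  qed
  show thesis
  proof (rule that[OF _ c])
    show "\<exists>y\<in>?V. c y \<noteq> 0"
      using c[OF \<omega>1(1) y(1)] \<omega>1(2) y(1) by (intro bexI[of _ y]) auto
  qed
qed

text \<open>
  In the equality case the fundamental stresses \<open>W f\<close> become diagonal in the basis that consists of
  the homogeneous coordinates and the vectors \<open>H f\<close>, hence each is of the form
  \<open>l * C f y * C f z\<close>. Its support is a complete graph, on at least \<open>d + 2\<close> vertices since \<open>C f\<close> is
  an affine dependence of generic points. These complete graphs are edge-disjoint, so there is room
  for one of them only.
\<close>

lemma rigidity_bound_equality:
  assumes d: "d > 0" and G: "simple_graph G" and indep: "stress_independent d G"
    and n: "d + 2 \<le> card (verts G)"
    and eq: "card (edges G) + Suc d = rigidity_rank d G + card (verts G)"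
  shows "is_complete_graph (d + 2) G"
proof -
  let ?V = "verts G"
  let ?E = "edges G"
  let ?p = "generic_framework d ?V"
  note V = simple_graphD(1)[OF G] and E = simple_graphD(2)[OF G] and finE = simple_graphD(3)[OF G]
  have p: "generic d ?V ?p" by (rule generic_framework_generic[OF V])
  obtain F W where F: "F \<subseteq> ?E" "card F = rigidity_rank d G"
    and W: "\<And>f. f \<in> ?E - F \<Longrightarrow> is_stress d ?V ?E ?p (W f)"
      "\<And>f g. f \<in> ?E - F \<Longrightarrow> g \<in> ?E - F \<Longrightarrow> W f g = (if g = f then 1 else 0)"
    by (rule fundamental_stresses[OF G p]) blast
  define B where "B = ?E - F"
  have finB: "finite B" using finE by (simp add: B_def)
  have cardB: "card ?E = rigidity_rank d G + card B"
    unfolding B_def F(2)[symmetric]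
    using card_Diff_subset[OF finite_subset[OF F(1) finE] F(1)] card_mono[OF finE F(1)] by simp
  have nB: "card ?V = card B + Suc d" using eq cardB by simp
  note W = W[folded B_def]
  have off: "W f e = 0" if "f \<in> B" "e \<notin> ?E" for f e
    using W(1)[OF that(1)] that(2) unfolding is_stress_def by blast
  let ?hc = "hom_coord d ?p"
  let ?A = "\<lambda>f. stress_apply ?V (W f)"
  \<comment> \<open>\<open>h\<close> and \<open>c\<close> are paired so that one application of
    choice selects both.\<close>
  have "\<forall>f\<in>B. \<exists>hc. (\<exists>y\<in>?V. snd hc y \<noteq> 0) \<and>
    (\<forall>\<omega> y. is_stress d ?V ?E ?p \<omega> \<longrightarrow> y \<in> ?V \<longrightarrow> stress_apply ?V \<omega> (fst hc) y = \<omega> f * snd hc y)"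
  proof
    fix f assume f: "f \<in> B"
    then have "W f f \<noteq> 0" using W(2)[OF f f] by simp
    then obtain h c where "\<exists>y\<in>?V. c y \<noteq> 0"
      "\<And>\<omega> y. is_stress d ?V ?E ?p \<omega> \<Longrightarrow> y \<in> ?V \<Longrightarrow> stress_apply ?V \<omega> h y = \<omega> f * c y"
      by (rule stress_independent_rank_one[OF G indep p W(1)[OF f]]) blast
    then show "\<exists>hc. (\<exists>y\<in>?V. snd hc y \<noteq> 0) \<and>
      (\<forall>\<omega> y. is_stress d ?V ?E ?p \<omega> \<longrightarrow> y \<in> ?V \<longrightarrow> stress_apply ?V \<omega> (fst hc) y = \<omega> f * snd hc y)"
      by (intro exI[of _ "(h, c)"]) simp
  qed
  from bchoice[OF this] obtain HC where HC: "\<forall>f\<in>B. (\<exists>y\<in>?V. snd (HC f) y \<noteq> 0) \<and>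
    (\<forall>\<omega> y. is_stress d ?V ?E ?p \<omega> \<longrightarrow> y \<in> ?V \<longrightarrow>
      stress_apply ?V \<omega> (fst (HC f)) y = \<omega> f * snd (HC f) y)" ..
  define H where "H f = fst (HC f)" for f
  define C where "C f = snd (HC f)" for f
  have C0: "\<exists>y\<in>?V. C f y \<noteq> 0" if "f \<in> B" for f
    using bspec[OF HC that] unfolding C_def by blast
  have WH: "?A g (H f) y = (if f = g then C f y else 0)" if "f \<in> B" "g \<in> B" "y \<in> ?V" for f g y
    using bspec[OF HC that(1)] W(1)[OF that(2)] that(3) W(2)[OF that(2,1)]
    unfolding C_def H_def by simp
  let ?Q = "case_sum ?hc H"
  \<comment> \<open>By symmetry the image of \<open>W f\<close> is orthogonal to whatever
    \<open>W f\<close> annihilates, and this includes all of \<open>?Q\<close> except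
    \<open>H f\<close>.\<close>
  have AQ: "(\<Sum>v\<in>?V. ?Q i v * ?A f h v) = 0" if f: "f \<in> B" and i: "i \<in> {..d} <+> (B - {f})" for f i h
  proof (cases i)
    case (Inl a)
    then show ?thesis
      using stress_apply_orthogonal_hom_coord[OF W(1)[OF f], of h a] by (simp add: mult.commute)
  next
    case (Inr g)
    then have g: "g \<in> B" "g \<noteq> f" using i by auto
    have "(\<Sum>v\<in>?V. h v * ?A f (H g) v) = 0"
      using WH[OF g(1) f] g(2) by simp
    then show ?thesis
      using Inr stress_apply_symmetric[of "H g" ?V "W f" h] by simp
  qed
  have CQ: "(\<Sum>v\<in>?V. ?Q i v * C f v) = 0" if f: "f \<in> B" and i: "i \<in> {..d} <+> (B - {f})" for f i
  proof -
    have "(\<Sum>v\<in>?V. ?Q i v * C f v) = (\<Sum>v\<in>?V. ?Q i v * ?A f (H f) v)"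
      by (rule sum.cong) (simp_all add: WH[OF f f])
    then show ?thesis using AQ[OF f i] by simp
  qed
  \<comment> \<open>Applying \<open>W f\<close> to a vanishing combination leaves only the
    coefficient at \<open>H f\<close>, times \<open>C f\<close>. By \<open>nB\<close> the family has
    \<open>card ?V\<close> members, so it is a basis.\<close>
  have Q: "lin_indep ({..d} <+> B) ?V ?Q"
    unfolding lin_indep_def
  proof (intro allI impI)
    fix a assume a: "\<forall>v\<in>?V. (\<Sum>i\<in>{..d} <+> B. a i * ?Q i v) = 0"
    have split: "(\<Sum>i\<in>{..d} <+> B. a i * ?Q i v) =
        (\<Sum>i\<le>d. a (Inl i) * ?hc i v) + (\<Sum>f\<in>B. a (Inr f) * H f v)" for v
      using finB by (simp add: sum.Plus)
    have aR: "a (Inr f) = 0" if f: "f \<in> B" for f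
    proof -
      obtain y where y: "y \<in> ?V" "C f y \<noteq> 0" using C0[OF f] by blast
      have "?A f (\<lambda>v. \<Sum>i\<in>{..d} <+> B. a i * ?Q i v) y = ?A f (\<lambda>v. 0) y"
        by (rule stress_apply_cong) (use a y in auto)
      then have "0 = ?A f (\<lambda>v. (\<Sum>i\<le>d. a (Inl i) * ?hc i v) + (\<Sum>f\<in>B. a (Inr f) * H f v)) y"
        unfolding split by simp
      also have "\<dots> = (\<Sum>i\<le>d. a (Inl i) * ?A f (?hc i) y) + (\<Sum>g\<in>B. a (Inr g) * ?A f (H g) y)"
        unfolding stress_apply_add_point stress_apply_sum_point ..
      also have "(\<Sum>i\<le>d. a (Inl i) * ?A f (?hc i) y) = 0"
        using stress_apply_hom_coord[OF W(1)[OF f] y(1)] by simp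
      also have "(\<Sum>g\<in>B. a (Inr g) * ?A f (H g) y) =
          (\<Sum>g\<in>B. a (Inr g) * C g y * (if g = f then 1 else 0))"
        by (rule sum.cong) (use WH[OF _ f y(1)] in auto)
      also have "\<dots> = a (Inr f) * C f y"
        by (rule sum_mult_unit_vector[OF finB f])
      finally show ?thesis using y(2) by simp
    qed
    then have "\<forall>v\<in>?V. (\<Sum>i\<le>d. a (Inl i) * ?hc i v) = 0"
      using a unfolding split by simp
    then have "\<forall>i\<in>{..d}. a (Inl i) = 0"
      using spec[OF lin_indep_hom_coord[OF V _ p, unfolded lin_indep_def], of "\<lambda>i. a (Inl i)"] n
      by simp
    then show "\<forall>i\<in>{..d} <+> B. a i = 0" using aR by auto
  qed
  have Qf: "lin_indep ({..d} <+> (B - {f})) ?V ?Q" for f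
    by (rule lin_indep_subset[OF Q]) (use finB in auto)
  \<comment> \<open>Omitting \<open>H f\<close> from the basis leaves a one-dimensional orthogonal
    complement, which \<open>C f\<close> spans. Indexing the pair \<open>x\<close>,
    \<open>C f\<close> by \<open>bool\<close> allows the two to coincide.\<close>
  have line: "\<exists>s. \<forall>v\<in>?V. x v = s * C f v"
    if f: "f \<in> B" and x: "\<And>i. i \<in> {..d} <+> (B - {f}) \<Longrightarrow> (\<Sum>v\<in>?V. ?Q i v * x v) = 0" for f x
  proof -
    let ?X = "\<lambda>b :: bool. if b then x else C f"
    have "\<not> lin_indep UNIV ?V ?X"
    proof
      assume X: "lin_indep UNIV ?V ?X"
      have "card ({..d} <+> (B - {f})) + card (UNIV :: bool set) \<le> card ?V"
        by (rule lin_indep_orthogonal_card[OF V _ _ Qf X]) (use finB x CQ[OF f] in auto)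
      moreover have "Suc (card (B - {f})) = card B"
        using finB f by (rule card_Suc_Diff1)
      ultimately show False using nB finB by (simp add: card_Plus)
    qed
    then obtain a where a: "\<forall>v\<in>?V. (\<Sum>b\<in>UNIV. a b * ?X b v) = 0" "\<exists>b. a b \<noteq> 0"
      unfolding lin_indep_def by auto
    have a1: "a True * x v + a False * C f v = 0" if "v \<in> ?V" for v
      using bspec[OF a(1) that] by (simp add: UNIV_bool add.commute)
    have "a True \<noteq> 0"
    proof
      assume 0: "a True = 0"
      then have "a False \<noteq> 0" using a(2) by (metis (full_types))
      then show False using a1 0 C0[OF f] by auto
    qed
    then have "x v = - a False / a True * C f v" if "v \<in> ?V" for v
      using a1[OF that] by (simp add: field_simps eq_neg_iff_add_eq_0)
    then show ?thesis by blast
  qed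
  have line_apply: "\<exists>s. \<forall>v\<in>?V. ?A f h v = s * C f v" if "f \<in> B" for f h
    by (rule line[OF that]) (rule AQ[OF that])
  define supp where "supp f = {v \<in> ?V. C f v \<noteq> 0}" for f
  have finsupp: "finite (supp f)" for f using V by (simp add: supp_def)
  have card_supp: "d + 2 \<le> card (supp f)" if f: "f \<in> B" for f
  proof (rule ccontr)
    assume "\<not> d + 2 \<le> card (supp f)"
    moreover have "generic d (supp f) ?p"
      by (rule generic_subset[OF p]) (auto simp: supp_def)
    moreover have "\<forall>i\<le>d. (\<Sum>v\<in>supp f. C f v * ?hc i v) = 0"
    proof (intro allI impI)
      fix i assume "i \<le> d"
      then have "(\<Sum>v\<in>?V. C f v * ?hc i v) = 0"
        using CQ[OF f InlI[of i "{..d}" "B - {f}"]] by (simp add: mult.commute)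
      moreover have "(\<Sum>v\<in>supp f. C f v * ?hc i v) = (\<Sum>v\<in>?V. C f v * ?hc i v)"
        by (rule sum.mono_neutral_left) (use V in \<open>auto simp: supp_def\<close>)
      ultimately show "(\<Sum>v\<in>supp f. C f v * ?hc i v) = 0" by simp
    qed
    ultimately have "\<forall>v\<in>supp f. C f v = 0"
      by (intro hom_coord_affinely_independent[OF finsupp]) auto
    then show False using C0[OF f] unfolding supp_def by blast
  qed
  have clique: "W f {y, z} \<noteq> 0" if f: "f \<in> B" and y: "y \<in> supp f" and z: "z \<in> supp f" and "y \<noteq> z" for f y z
  proof -
    define \<delta> where "\<delta> z v = (if v = z then 1 else 0 :: real)" for z v :: 'a
    have A\<delta>: "?A f (\<delta> z) y = W f {y, z}" if "z \<in> ?V" "y \<noteq> z" for y z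
    proof -
      have "?A f (\<delta> z) y = (\<Sum>x\<in>?V. W f {x, y} * (if x = z then 1 else 0))"
        unfolding stress_apply_def by (rule sum.cong) (use that in \<open>auto simp: \<delta>_def\<close>)
      also have "\<dots> = W f {z, y}"
        by (rule sum_mult_unit_vector[OF V that(1)])
      finally show ?thesis by (simp add: insert_commute)
    qed
    have "\<forall>z. \<exists>s. \<forall>v\<in>?V. ?A f (\<delta> z) v = s * C f v"
      using line_apply[OF f] by blast
    from choice[OF this] obtain s where s: "\<And>z v. v \<in> ?V \<Longrightarrow> ?A f (\<delta> z) v = s z * C f v" by blast
    \<comment> \<open>The unit vector at \<open>z\<close> is sent to \<open>s z\<close> times
      \<open>C f\<close>; symmetry of the edge weights makes \<open>s\<close> proportional to
      \<open>C f\<close>, so off the diagonal \<open>W f\<close> is a product.\<close>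
    have sym: "s z * C f y = s y * C f z" if "y \<in> ?V" "z \<in> ?V" for y z
    proof (cases "y = z")
      case False
      then show ?thesis
        using s[OF that(1), of z] s[OF that(2), of y] A\<delta>[OF that(2) False] A\<delta>[OF that(1), of z]
        by (simp add: insert_commute)
    qed simp
    have yV: "y \<in> ?V" "z \<in> ?V" "C f y \<noteq> 0" "C f z \<noteq> 0" using y z by (simp_all add: supp_def)
    define l where "l = s y / C f y"
    have sl: "s w = l * C f w" if "w \<in> ?V" for w
      using sym[OF yV(1) that] yV(3) by (simp add: l_def field_simps)
    have Wl: "W f {a, b} = l * C f b * C f a" if "a \<in> ?V" "b \<in> ?V" "a \<noteq> b" for a b
      using A\<delta>[OF that(2,3)] s[OF that(1), of b] sl[OF that(2)] by simp
    have "l \<noteq> 0"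
    proof
      assume "l = 0"
      have "f \<in> nsets ?V 2" using f E unfolding B_def by blast
      then obtain a b where "f = {a, b}" "a \<in> ?V" "b \<in> ?V" "a \<noteq> b" by (rule nsets_2_E)
      then have "W f f = 0" using Wl[of a b] \<open>l = 0\<close> by simp
      then show False using W(2)[OF f f] by simp
    qed
    then show ?thesis using Wl[OF yV(1,2) \<open>y \<noteq> z\<close>] yV(3,4) by simp
  qed
  define D where "D f = {e \<in> ?E. W f e \<noteq> 0}" for f
  have finD: "finite (D f)" for f using finE by (simp add: D_def)
  have card_D: "d + 2 choose 2 \<le> card (D f)" if f: "f \<in> B" for f
  proof -
    have "nsets (supp f) 2 \<subseteq> D f"
    proof
      fix e assume "e \<in> nsets (supp f) 2"
      then obtain y z where "e = {y, z}" "y \<in> supp f" "z \<in> supp f" "y \<noteq> z" by (rule nsets_2_E)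
      then have "W f e \<noteq> 0" using clique[OF f] by simp
      moreover from this have "e \<in> ?E" using off[OF f] by blast
      ultimately show "e \<in> D f" by (simp add: D_def)
    qed
    then have "card (nsets (supp f) 2) \<le> card (D f)"
      by (rule card_mono[OF finD])
    moreover have "d + 2 choose 2 \<le> card (supp f) choose 2"
      unfolding choose_two by (intro div_le_mono mult_le_mono diff_le_mono card_supp[OF f])
    ultimately show ?thesis by (simp add: card_nsets)
  qed
  have disjoint: "D f \<inter> D g = {}" if f: "f \<in> B" and g: "g \<in> B" and fg: "f \<noteq> g" for f g
  proof (rule ccontr)
    assume "D f \<inter> D g \<noteq> {}"
    then obtain e where e: "W f e \<noteq> 0" "W g e \<noteq> 0" by (auto simp: D_def)
    obtain h c where c0: "\<exists>y\<in>?V. c y \<noteq> 0"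
      and c: "\<And>\<omega> y. is_stress d ?V ?E ?p \<omega> \<Longrightarrow> y \<in> ?V \<Longrightarrow> stress_apply ?V \<omega> h y = \<omega> e * c y"
      by (rule stress_independent_rank_one[OF G indep p W(1)[OF f] e(1)]) blast
    obtain y where y: "y \<in> ?V" "c y \<noteq> 0" using c0 by blast
    obtain s where s: "\<And>v. v \<in> ?V \<Longrightarrow> ?A f h v = s * C f v" using line_apply[OF f, of h] by blast
    obtain t where t: "\<And>v. v \<in> ?V \<Longrightarrow> ?A g h v = t * C g v" using line_apply[OF g, of h] by blast
    have cf: "c v = s / W f e * C f v" if "v \<in> ?V" for v
      using c[OF W(1)[OF f] that] s[OF that] e(1) by (simp add: field_simps)
    have cg: "c v = t / W g e * C g v" if "v \<in> ?V" for v
      using c[OF W(1)[OF g] that] t[OF that] e(2) by (simp add: field_simps)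
    \<comment> \<open>\<open>c\<close> is a multiple of both \<open>C f\<close> and
      \<open>C g\<close>. The former is orthogonal to all of \<open>?Q\<close> except
      \<open>H f\<close>, the latter to \<open>H f\<close>; so the nonzero \<open>c\<close> would be
      orthogonal to a basis.\<close>
    have "card ({..d} <+> B) + card {0 :: nat} \<le> card ?V"
    proof (rule lin_indep_orthogonal_card[OF V _ _ Q])
      show "lin_indep {0 :: nat} ?V (\<lambda>_. c)" by (rule lin_indep_single[of y _ c, OF y])
      fix i and b :: nat assume i: "i \<in> {..d} <+> B"
      show "(\<Sum>v\<in>?V. ?Q i v * c v) = 0"
      proof (cases "i = Inr f")
        case False
        then have "(\<Sum>v\<in>?V. ?Q i v * C f v) = 0" using i by (intro CQ[OF f]) auto
        then have "s / W f e * (\<Sum>v\<in>?V. ?Q i v * C f v) = 0" by simp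
        moreover have "(\<Sum>v\<in>?V. ?Q i v * c v) = s / W f e * (\<Sum>v\<in>?V. ?Q i v * C f v)"
          unfolding sum_distrib_left by (rule sum.cong) (simp_all add: cf)
        ultimately show ?thesis by simp
      next
        case True
        then have "(\<Sum>v\<in>?V. ?Q i v * C g v) = 0" using i fg by (intro CQ[OF g]) auto
        then have "t / W g e * (\<Sum>v\<in>?V. ?Q i v * C g v) = 0" by simp
        moreover have "(\<Sum>v\<in>?V. ?Q i v * c v) = t / W g e * (\<Sum>v\<in>?V. ?Q i v * C g v)"
          unfolding sum_distrib_left by (rule sum.cong) (simp_all add: cg)
        ultimately show ?thesis by simp
      qed
    qed (use finB in auto)
    then show False using nB finB by (simp add: card_Plus)
  qed
  have "card B * (d + 2 choose 2) \<le> (\<Sum>f\<in>B. card (D f))"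
    using sum_mono[of B "\<lambda>_. d + 2 choose 2" "\<lambda>f. card (D f)"] card_D by simp
  also have "\<dots> = card (\<Union>f\<in>B. D f)"
    using disjoint finD by (intro card_UN_disjoint[symmetric] finB) auto
  also have "\<dots> \<le> card ?E"
    by (rule card_mono[OF finE]) (auto simp: D_def)
  finally have many: "card B * (d + 2 choose 2) \<le> card ?E" .
  have rank: "rigidity_rank d G + (Suc d choose 2) \<le> d * card ?V"
    by (rule rigidity_rank_le[OF G]) (use n in simp)
  have ch: "d + 2 choose 2 = (Suc d choose 2) + Suc d"
    by (simp add: numeral_2_eq_2)
  have ch2: "2 * (d + 2 choose 2) = (d + 2) * (d + 1)"
    by (simp add: choose_two)
  have B1: "card B = 1"
  proof -
    let ?m = "card B"
    have m: "1 \<le> ?m" using nB n by simp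
    \<comment> \<open>With m = \<open>?m\<close>, \<open>many\<close> and \<open>rank\<close> give m
      * binom(d+2, 2) \<le> d (m+d+1) - binom(d+1, 2) + m, and \<open>ch\<close> replaces binom(d+1,
      2) by binom(d+2, 2) - (d+1). Doubling and cancelling d + 1 then leaves m d \<le> d.\<close>
    have "(?m + 1) * (d + 2 choose 2) \<le> (d + 1) * (?m + d + 1)"
      using many rank cardB ch nB by (simp add: algebra_simps)
    then have "2 * ((?m + 1) * (d + 2 choose 2)) \<le> 2 * ((d + 1) * (?m + d + 1))"
      by (rule mult_le_mono2)
    then have "(d + 1) * ((?m + 1) * (d + 2)) \<le> (d + 1) * (2 * (?m + d + 1))"
      using ch2 by (metis (no_types, opaque_lifting) mult.assoc mult.commute)
    then have "(?m + 1) * (d + 2) \<le> 2 * (?m + d + 1)"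
      unfolding mult_le_cancel1 by (rule mp) simp
    then have "?m * d \<le> 1 * d" by (simp add: algebra_simps)
    then have "?m \<le> 1" using d by simp
    then show ?thesis using m by simp
  qed
  then have nV: "card ?V = d + 2" using nB by simp
  have "card (nsets ?V 2) \<le> card ?E" using many B1 by (simp add: card_nsets nV)
  then have "?E = nsets ?V 2"
    using E V by (intro card_seteq finite_imp_finite_nsets)
  then show ?thesis unfolding is_complete_graph_def using nV by simp
qed

theorem theorem4p4:
  fixes d :: nat and G :: "'a ugraph"
  assumes "d > 0"
    and "simple_graph G"
    and "stress_independent d G"
  shows "rigidity_independent (d + 1) G \<and>
    (\<forall>G'. subgraph_of G' G \<and> card (verts G') \<ge> d + 2 \<longrightarrow>
       int (card (edges G')) \<le> int (rigidity_rank d G') + int (card (verts G')) - int d - 1 \<and>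
       int (rigidity_rank d G') + int (card (verts G')) - int d - 1
         \<le> (int d + 1) * int (card (verts G')) - int ((d + 2) choose 2) \<and>
       (int (card (edges G')) = int (rigidity_rank d G') + int (card (verts G')) - int d - 1
         \<longleftrightarrow> is_complete_graph (d + 2) G'))"
proof (intro conjI allI impI; (elim conjE)?)
  show "rigidity_independent (d + 1) G"
    using rigidity_independent_of_stress_independent[OF assms(2,3)] by simp
next
  fix G' :: "'a ugraph"
  assume sub: "subgraph_of G' G" and n: "d + 2 \<le> card (verts G')"
  have G': "simple_graph G'" using sub unfolding subgraph_of_def by simp
  have indep: "stress_independent d G'"
    by (rule stress_independent_subgraph[OF assms(2) sub assms(3)])
  let ?e = "card (edges G')" and ?r = "rigidity_rank d G'" and ?n = "card (verts G')"
  have n': "Suc d \<le> ?n" using n by simp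
  have upper: "?e + Suc d \<le> ?r + ?n"
    by (rule rigidity_independent_card_bound[OF G' n'
          rigidity_independent_of_stress_independent[OF G' indep]])
  then show "int ?e \<le> int ?r + int ?n - int d - 1" by linarith
  have ch: "d + 2 choose 2 = (Suc d choose 2) + Suc d"
    by (simp add: numeral_2_eq_2)
  have "?r + (d + 2 choose 2) \<le> d * ?n + Suc d"
    using rigidity_rank_le[OF G' n'] ch by simp
  then have "int ?r + int (d + 2 choose 2) \<le> int d * int ?n + int d + 1"
    by (metis (no_types, lifting) Suc_eq_plus1 add.assoc of_nat_1 of_nat_add of_nat_le_iff of_nat_mult)
  then show lower: "int ?r + int ?n - int d - 1 \<le> (int d + 1) * int ?n - int ((d + 2) choose 2)"
    by (simp add: algebra_simps)
  show "int ?e = int ?r + int ?n - int d - 1 \<longleftrightarrow> is_complete_graph (d + 2) G'"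
  proof
    assume "int ?e = int ?r + int ?n - int d - 1"
    then have "?e + Suc d = ?r + ?n" by linarith
    then show "is_complete_graph (d + 2) G'"
      by (rule rigidity_bound_equality[OF assms(1) G' indep n])
  next
    assume "is_complete_graph (d + 2) G'"
    then have K: "?n = d + 2" "?e = d + 2 choose 2"
      unfolding is_complete_graph_def by (simp_all add: card_nsets)
    \<comment> \<open>For a complete graph on d + 2 vertices the two ends of the chain of
      inequalities agree, so \<open>upper\<close> and \<open>lower\<close> force equality without a
      computation of the rank.\<close>
    have "2 * (d + 2 choose 2) = (d + 2) * (d + 1)"
      by (simp add: choose_two)
    then have "int ((d + 2) choose 2) * 2 = (int d + 2) * (int d + 1)"
      by (metis (no_types, lifting) mult.commute of_nat_1 of_nat_add of_nat_mult of_nat_numeral)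
    then show "int ?e = int ?r + int ?n - int d - 1"
      using upper lower K by (simp add: algebra_simps)
  qed
qed

end
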